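(* Let $\mathcal{L}$ be a left Hopf algebroid over an algebra $B$ and let $\varsigma\in{}_B\mathrm{Hom}_B(\mathcal{L}\otimes_{B^e}\mathcal{L},B)$ be an invertible normalised 2-cocycle with convolution inverse $\varsigma^{-1}$. Then the left bialgebroid $\mathcal{L}^\varsigma$, which is $\mathcal{L}$ with the same $s,t,\Delta,\epsilon$ and the twisted product $$X\cdot_\varsigma Y=s(\varsigma(X_{(1)},Y_{(1)}))\,t(\varsigma^{-1}(X_{(3)},Y_{(3)}))\,X_{(2)}Y_{(2)},$$ is a left Hopf algebroid. The map $\lambda^\varsigma(X\otimes_{B^{op}}Y)=X_{(1)}\otimes_BX_{(2)}\cdot_\varsigma Y$ has inverse $$(\lambda^\varsigma)^{-1}(X\otimes_B Y)=t\big(\varsigma(X_{(1)+(2)},X_{(1)-(3)})\big)X_{(1)+(1)}\otimes_{B^{op}}s\big(\varsigma^{-1}(X_{(1)-(1)},X_{(2)})\big)X_{(1)-(2)}\cdot_\varsigma Y$$ for all $X,Y\in\mathcal{L}$. Here $X_{(1)+(i)}$ and $X_{(1)-(j)}$ denote the coproduct components of $X_{(1)+}$ and $X_{(1)-}$, and $X_+\otimes_{B^{op}}X_-=\lambda^{-1}(X\otimes_B1)$ is computed in the untwisted $\mathcal{L}$.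
   Context: All algebras are unital over a field $k$; $\Delta(X)=X_{(1)}\otimes_BX_{(2)}$ is sumless Sweedler notation; $B^e=B\otimes B^{op}$. Left $B$-bialgebroid: an algebra $\mathcal{L}$ with algebra maps $s:B\to\mathcal{L}$, $t:B^{op}\to\mathcal{L}$ with commuting images, and a $B$-coring structure $(\Delta,\epsilon)$ (coalgebra in $B$-bimodules) for the bimodule structure $b.X.c=s(b)t(c)X$, such that (i) $\Delta$ corestricts to an algebra map $\mathcal{L}\to\mathcal{L}\times_B\mathcal{L}=\{\sum_i X_i\otimes_B Y_i\mid \sum_i X_it(b)\otimes_B Y_i=\sum_i X_i\otimes_B Y_is(b)\ \forall b\in B\}\subseteq\mathcal{L}\otimes_B\mathcal{L}$ with factorwise product; (ii) $\epsilon(1)=1$, $\epsilon(s(b)X)=b\epsilon(X)$, $\epsilon(Xs(\epsilon(Y)))=\epsilon(XY)=\epsilon(Xt(\epsilon(Y)))$. Left Hopf algebroid: a left $B$-bialgebroid such that $\lambda:\mathcal{L}\otimes_{B^{op}}\mathcal{L}\to\mathcal{L}\otimes_B\mathcal{L}$, $\lambda(X\otimes_{B^{op}}Y)=X_{(1)}\otimes_B X_{(2)}Y$, is invertible, where $Xt(b)\otimes_{B^{op}}Y=X\otimes_{B^{op}}t(b)Y$ and $t(b)X\otimes_B Y=X\otimes_B s(b)Y$. The tensor product $\mathcal{L}\otimes_{B^e}\mathcal{L}$ is balanced by $\eta(b\otimes c)=s(b)t(c)$, i.e. $X\eta(b\otimes c)\otimes Y=X\otimes\eta(b\otimes c)Y$,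 and has bimodule structure $b.(X\otimes Y).c=s(b)t(c)X\otimes Y$. The set ${}_B\mathrm{Hom}_B(\mathcal{L}\otimes_{B^e}\mathcal{L},B)$ of $B$-bimodule maps is an algebra with product $(f\star g)(X,Y)=f(X_{(1)},Y_{(1)})g(X_{(2)},Y_{(2)})$ and unit $\tilde\epsilon(X\otimes Y)=\epsilon(XY)$. A normalised left 2-cocycle is a convolution-invertible element $\varsigma$ with $\varsigma(X,s(\varsigma(Y_{(1)},Z_{(1)}))Y_{(2)}Z_{(2)})=\varsigma(s(\varsigma(X_{(1)},Y_{(1)}))X_{(2)}Y_{(2)},Z)$ and $\varsigma(1,X)=\epsilon(X)=\varsigma(X,1)$. A normalised right 2-cocycle is a convolution-invertible element $\xi$ with $\xi(X,t(\xi(Y_{(2)},Z_{(2)}))Y_{(1)}Z_{(1)})=\xi(t(\xi(X_{(2)},Y_{(2)}))X_{(1)}Y_{(1)},Z)$ and $\xi(1,X)=\epsilon(X)=\xi(X,1)$. An invertible normalised 2-cocycle is a normalised left 2-cocycle whose convolution inverse is a normalised right 2-cocycle. For such $\varsigma$ it is known that $\mathcal{L}^\varsigma$ is a left $B$-bialgebroid. *)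

theory Defs
  imports Complex_Main "HOL-Library.Poly_Mapping"
begin

section \<open>Unital associative algebras over a field\<close>

locale k_algebra = vector_space scale
  for scale :: "'k::field \<Rightarrow> 'a::ab_group_add \<Rightarrow> 'a"
    and mult :: "'a \<Rightarrow> 'a \<Rightarrow> 'a"
    and one :: 'a +
  assumes mult_assoc: "mult (mult x y) z = mult x (mult y z)"
    and mult_one_left: "mult one x = x"
    and mult_one_right: "mult x one = x"
    and mult_add_left: "mult (x + y) z = mult x z + mult y z"
    and mult_add_right: "mult x (y + z) = mult x y + mult x z"
    and mult_scale_left: "mult (scale c x) y = scale c (mult x y)"
    and mult_scale_right: "mult x (scale c y) = scale c (mult x y)"

locale k_algebra_hom =
  dom: k_algebra scale1 mult1 one1 + cod: k_algebra scale2 mult2 one2 +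
  Vector_Spaces.linear scale1 scale2 f
  for scale1 :: "'k::field \<Rightarrow> 'a::ab_group_add \<Rightarrow> 'a" and mult1 one1
    and scale2 :: "'k \<Rightarrow> 'c::ab_group_add \<Rightarrow> 'c" and mult2 one2 and f +
  assumes hom_mult: "f (mult1 x y) = mult2 (f x) (f y)"
    and hom_one: "f one1 = one2"


section \<open>Tensor products as quotients of free vector spaces\<close>

text \<open>
  Formal \<open>k\<close>-linear combinations of generators of type \<open>'g\<close> are elements of \<open>'g \<Rightarrow>\<^sub>0 'k\<close>.
  A tensor product is the quotient of this free vector space by the span of a set \<open>R\<close> of relations;
  its elements are cosets.
\<close>

definition free_scale :: "'k::field \<Rightarrow> ('g \<Rightarrow>\<^sub>0 'k) \<Rightarrow> ('g \<Rightarrow>\<^sub>0 'k)" where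
  "free_scale c u = Poly_Mapping.map ((*) c) u"

abbreviation gen :: "'g \<Rightarrow> ('g \<Rightarrow>\<^sub>0 'k::field)" where
  "gen g \<equiv> Poly_Mapping.single g 1"

definition coset :: "('g \<Rightarrow>\<^sub>0 'k::field) set \<Rightarrow> ('g \<Rightarrow>\<^sub>0 'k) \<Rightarrow> ('g \<Rightarrow>\<^sub>0 'k) set" where
  "coset R u = {v. v - u \<in> module.span free_scale R}"

definition tensor_space :: "('g \<Rightarrow>\<^sub>0 'k::field) set \<Rightarrow> ('g \<Rightarrow>\<^sub>0 'k) set set" where
  "tensor_space R = range (coset R)"

text \<open>\<open>tsum R [(x\<^sub>1, y\<^sub>1), \<dots>, (x\<^sub>n, y\<^sub>n)]\<close> is the tensor \<open>\<Sum>\<^sub>i x\<^sub>i \<otimes> y\<^sub>i\<close>.\<close>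

definition tsum :: "('g \<Rightarrow>\<^sub>0 'k::field) set \<Rightarrow> 'g list \<Rightarrow> ('g \<Rightarrow>\<^sub>0 'k) set" where
  "tsum R gs = coset R (\<Sum>g\<leftarrow>gs. gen g)"

text \<open>
  A chosen way of writing a tensor as a finite sum of pure tensors (scalars are absorbed in
  the factors), as is implicit in Sweedler notation.  All expressions below in which it is used
  are independent of the choice for the structures to which they are applied.
\<close>

definition summands :: "('g \<Rightarrow>\<^sub>0 'k::field) set \<Rightarrow> ('g \<Rightarrow>\<^sub>0 'k) set \<Rightarrow> 'g list" where
  "summands R z = (SOME gs. tsum R gs = z)"

text \<open>
  Relations for \<open>M \<otimes> M\<close> balanced by \<open>x \<triangleleft> r \<otimes> y = x \<otimes> r \<triangleright> y\<close>, where \<open>x \<triangleleft> r\<close> is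
  \<open>ract r x\<close> and \<open>r \<triangleright> y\<close> is \<open>lact r y\<close>.
\<close>

definition tensor_rel ::
  "('k::field \<Rightarrow> 'a::ab_group_add \<Rightarrow> 'a) \<Rightarrow> ('r \<Rightarrow> 'a \<Rightarrow> 'a) \<Rightarrow> ('r \<Rightarrow> 'a \<Rightarrow> 'a)
    \<Rightarrow> ('a \<times> 'a \<Rightarrow>\<^sub>0 'k) set" where
  "tensor_rel scale ract lact =
     {gen (x + x', y) - gen (x, y) - gen (x', y) | x x' y. True}
   \<union> {gen (x, y + y') - gen (x, y) - gen (x, y') | x y y'. True}
   \<union> {gen (scale c x, y) - free_scale c (gen (x, y)) | c x y. True}
   \<union> {gen (x, scale c y) - free_scale c (gen (x, y)) | c x y. True}
   \<union> {gen (ract r x, y) - gen (x, lact r y) | r x y. True}"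

text \<open>The same for a triple tensor product, balanced at both tensor signs.\<close>

definition tensor3_rel ::
  "('k::field \<Rightarrow> 'a::ab_group_add \<Rightarrow> 'a) \<Rightarrow> ('r \<Rightarrow> 'a \<Rightarrow> 'a) \<Rightarrow> ('r \<Rightarrow> 'a \<Rightarrow> 'a)
    \<Rightarrow> ('a \<times> 'a \<times> 'a \<Rightarrow>\<^sub>0 'k) set" where
  "tensor3_rel scale ract lact =
     {gen (x + x', y, z) - gen (x, y, z) - gen (x', y, z) | x x' y z. True}
   \<union> {gen (x, y + y', z) - gen (x, y, z) - gen (x, y', z) | x y y' z. True}
   \<union> {gen (x, y, z + z') - gen (x, y, z) - gen (x, y, z') | x y z z'. True}
   \<union> {gen (scale c x, y, z) - free_scale c (gen (x, y, z)) | c x y z. True}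
   \<union> {gen (x, scale c y, z) - free_scale c (gen (x, y, z)) | c x y z. True}
   \<union> {gen (x, y, scale c z) - free_scale c (gen (x, y, z)) | c x y z. True}
   \<union> {gen (ract r x, y, z) - gen (x, lact r y, z) | r x y z. True}
   \<union> {gen (x, ract r y, z) - gen (x, y, lact r z) | r x y z. True}"


section \<open>Left bialgebroids and left Hopf algebroids\<close>

text \<open>
  The algebra \<open>B\<close> is the type \<open>'b\<close>; the sort \<open>{ring, monoid_mult}\<close> is that of unital rings, possibly zero.
  The additive group of \<open>\<L>\<close> is the type \<open>'l\<close>, its other operations are recorded here.
  The values of the coproduct are elements of \<open>\<L> \<otimes>\<^sub>B \<L>\<close>, i.e. cosets.
\<close>

record (overloaded) ('k, 'b, 'l) bialgebroid_data =
  scal :: "'k::field \<Rightarrow> 'l \<Rightarrow> 'l"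
  prd :: "'l \<Rightarrow> 'l \<Rightarrow> 'l"  (infixl \<open>\<cdot>\<index>\<close> 70)
  uno :: 'l  (\<open>\<one>\<index>\<close>)
  src :: "'b \<Rightarrow> 'l"
  tgt :: "'b \<Rightarrow> 'l"
  comult :: "'l \<Rightarrow> ('l \<times> 'l \<Rightarrow>\<^sub>0 'k) set"
  counit :: "'l \<Rightarrow> 'b"

text \<open>\<open>\<L> \<otimes>\<^sub>B \<L>\<close>: \<open>t(b)X \<otimes> Y = X \<otimes> s(b)Y\<close>\<close>

definition rel_B ::
  "('k::field, 'b, 'l::ab_group_add) bialgebroid_data \<Rightarrow> ('l \<times> 'l \<Rightarrow>\<^sub>0 'k) set" where
  "rel_B L = tensor_rel (scal L) (\<lambda>b X. tgt L b \<cdot>\<^bsub>L\<^esub> X) (\<lambda>b Y. src L b \<cdot>\<^bsub>L\<^esub> Y)"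

definition rel_BB ::
  "('k::field, 'b, 'l::ab_group_add) bialgebroid_data \<Rightarrow> ('l \<times> 'l \<times> 'l \<Rightarrow>\<^sub>0 'k) set" where
  "rel_BB L = tensor3_rel (scal L) (\<lambda>b X. tgt L b \<cdot>\<^bsub>L\<^esub> X) (\<lambda>b Y. src L b \<cdot>\<^bsub>L\<^esub> Y)"

text \<open>\<open>\<L> \<otimes> \<L>\<close> over \<open>B\<^sup>o\<^sup>p\<close>: \<open>Xt(b) \<otimes> Y = X \<otimes> t(b)Y\<close>\<close>

definition rel_op ::
  "('k::field, 'b, 'l::ab_group_add) bialgebroid_data \<Rightarrow> ('l \<times> 'l \<Rightarrow>\<^sub>0 'k) set" where
  "rel_op L = tensor_rel (scal L) (\<lambda>b X. X \<cdot>\<^bsub>L\<^esub> tgt L b) (\<lambda>b Y. tgt L b \<cdot>\<^bsub>L\<^esub> Y)"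

text \<open>
  \<open>\<L> \<otimes> \<L>\<close> over \<open>B\<^sup>e\<close>: \<open>X\<eta>(b \<otimes> c) \<otimes> Y = X \<otimes> \<eta>(b \<otimes> c)Y\<close>; balancing over the pure tensors
  \<open>b \<otimes> c\<close> suffices, since they span \<open>B\<^sup>e\<close>.
\<close>

definition eta :: "('k::field, 'b, 'l) bialgebroid_data \<Rightarrow> 'b \<Rightarrow> 'b \<Rightarrow> 'l" where
  "eta L b c = src L b \<cdot>\<^bsub>L\<^esub> tgt L c"

definition rel_e ::
  "('k::field, 'b, 'l::ab_group_add) bialgebroid_data \<Rightarrow> ('l \<times> 'l \<Rightarrow>\<^sub>0 'k) set" where
  "rel_e L = tensor_rel (scal L)
     (\<lambda>(b, c) X. X \<cdot>\<^bsub>L\<^esub> eta L b c) (\<lambda>(b, c) Y. eta L b c \<cdot>\<^bsub>L\<^esub> Y)"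

text \<open>\<open>sw L X\<close> lists the pairs \<open>(X\<^sub>(\<^sub>1\<^sub>), X\<^sub>(\<^sub>2\<^sub>))\<close>, \<open>sw3 L X\<close> the triples \<open>(X\<^sub>(\<^sub>1\<^sub>), X\<^sub>(\<^sub>2\<^sub>), X\<^sub>(\<^sub>3\<^sub>))\<close>.\<close>

definition sw :: "('k::field, 'b, 'l::ab_group_add) bialgebroid_data \<Rightarrow> 'l \<Rightarrow> ('l \<times> 'l) list" where
  "sw L X = summands (rel_B L) (comult L X)"

definition sw3 :: "('k::field, 'b, 'l::ab_group_add) bialgebroid_data \<Rightarrow> 'l \<Rightarrow> ('l \<times> 'l \<times> 'l) list" where
  "sw3 L X = [(X1, X2, X3). (X', X3) \<leftarrow> sw L X, (X1, X2) \<leftarrow> sw L X']"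

definition takeuchi ::
  "('k::field, 'b, 'l::ab_group_add) bialgebroid_data \<Rightarrow> ('l \<times> 'l \<Rightarrow>\<^sub>0 'k) set set" where
  "takeuchi L = {tsum (rel_B L) gs | gs.
     \<forall>b. tsum (rel_B L) [(X \<cdot>\<^bsub>L\<^esub> tgt L b, Y). (X, Y) \<leftarrow> gs]
       = tsum (rel_B L) [(X, Y \<cdot>\<^bsub>L\<^esub> src L b). (X, Y) \<leftarrow> gs]}"

text \<open>
  Maps of \<open>B\<close>-bimodules are only required to be additive and to commute with the actions of \<open>B\<close>:
  \<open>k\<close>-linearity follows, since \<open>k\<close> acts through \<open>B\<close>.
\<close>

locale left_bialgebroid =
  B: k_algebra scaleB "(*)" 1 +
  L: k_algebra "scal L" "prd L" "uno L" +
  s: k_algebra_hom scaleB "(*)" 1 "scal L" "prd L" "uno L" "src L" +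
  t: k_algebra_hom scaleB "\<lambda>b c. c * b" 1 "scal L" "prd L" "uno L" "tgt L"
  for scaleB :: "'k::field \<Rightarrow> 'b::{ring, monoid_mult} \<Rightarrow> 'b"
    and L :: "('k, 'b, 'l::ab_group_add) bialgebroid_data" (structure) +
  assumes src_tgt_commute: "src L b \<cdot> tgt L c = tgt L c \<cdot> src L b"
    \<comment> \<open>\<open>B\<close>-coring: \<open>\<Delta>\<close> and \<open>\<epsilon>\<close> are bimodule maps, coassociativity and counit laws\<close>
    and comult_in: "comult L X \<in> tensor_space (rel_B L)"
    and comult_add: "comult L (X + Y) = tsum (rel_B L) (sw L X @ sw L Y)"
    and comult_bimodule:
      "comult L (src L b \<cdot> tgt L c \<cdot> X)
        = tsum (rel_B L) [(src L b \<cdot> X1, tgt L c \<cdot> X2). (X1, X2) \<leftarrow> sw L X]"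
    and counit_add: "counit L (X + Y) = counit L X + counit L Y"
    and counit_bimodule: "counit L (src L b \<cdot> tgt L c \<cdot> X) = b * counit L X * c"
    and coassoc:
      "tsum (rel_BB L) [(X1, X2, X3). (X', X3) \<leftarrow> sw L X, (X1, X2) \<leftarrow> sw L X']
        = tsum (rel_BB L) [(X1, X2, X3). (X1, X') \<leftarrow> sw L X, (X2, X3) \<leftarrow> sw L X']"
    and counit_left: "(\<Sum>(X1, X2)\<leftarrow>sw L X. src L (counit L X1) \<cdot> X2) = X"
    and counit_right: "(\<Sum>(X1, X2)\<leftarrow>sw L X. tgt L (counit L X2) \<cdot> X1) = X"
    \<comment> \<open>\<open>\<Delta>\<close> corestricts to an algebra map into the Takeuchi product\<close>
    and comult_takeuchi: "comult L X \<in> takeuchi L"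
    and comult_mult:
      "comult L (X \<cdot> Y)
        = tsum (rel_B L) [(X1 \<cdot> Y1, X2 \<cdot> Y2). (X1, X2) \<leftarrow> sw L X, (Y1, Y2) \<leftarrow> sw L Y]"
    and comult_one: "comult L \<one> = tsum (rel_B L) [(\<one>, \<one>)]"
    and counit_one: "counit L \<one> = 1"
    and counit_src: "counit L (src L b \<cdot> X) = b * counit L X"
    and counit_mult_src: "counit L (X \<cdot> src L (counit L Y)) = counit L (X \<cdot> Y)"
    and counit_mult_tgt: "counit L (X \<cdot> tgt L (counit L Y)) = counit L (X \<cdot> Y)"

text \<open>The Galois map \<open>\<lambda>(X \<otimes> Y) = X\<^sub>(\<^sub>1\<^sub>) \<otimes> X\<^sub>(\<^sub>2\<^sub>)Y\<close>, from the tensor product over \<open>B\<^sup>o\<^sup>p\<close> to that over \<open>B\<close>\<close>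

definition galois ::
  "('k::field, 'b, 'l::ab_group_add) bialgebroid_data
    \<Rightarrow> ('l \<times> 'l \<Rightarrow>\<^sub>0 'k) set \<Rightarrow> ('l \<times> 'l \<Rightarrow>\<^sub>0 'k) set" where
  "galois L z =
     tsum (rel_B L) [(X1, X2 \<cdot>\<^bsub>L\<^esub> Y). (X, Y) \<leftarrow> summands (rel_op L) z, (X1, X2) \<leftarrow> sw L X]"

definition galois_inv ::
  "('k::field, 'b, 'l::ab_group_add) bialgebroid_data
    \<Rightarrow> ('l \<times> 'l \<Rightarrow>\<^sub>0 'k) set \<Rightarrow> ('l \<times> 'l \<Rightarrow>\<^sub>0 'k) set" where
  "galois_inv L = inv_into (tensor_space (rel_op L)) (galois L)"

locale left_hopf_algebroid = left_bialgebroid +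
  assumes galois_bij: "bij_betw (galois L) (tensor_space (rel_op L)) (tensor_space (rel_B L))"

text \<open>The pairs \<open>(X\<^sub>+, X\<^sub>-)\<close>\<close>

definition pm :: "('k::field, 'b, 'l::ab_group_add) bialgebroid_data \<Rightarrow> 'l \<Rightarrow> ('l \<times> 'l) list" where
  "pm L X = summands (rel_op L) (galois_inv L (tsum (rel_B L) [(X, \<one>\<^bsub>L\<^esub>)]))"


section \<open>Convolution and 2-cocycles\<close>

definition bimodule_hom ::
  "('k::field, 'b::{ring, monoid_mult}, 'l::ab_group_add) bialgebroid_data
    \<Rightarrow> (('l \<times> 'l \<Rightarrow>\<^sub>0 'k) set \<Rightarrow> 'b) set" where
  "bimodule_hom L = {f.
     (\<forall>u v. f (coset (rel_e L) (u + v)) = f (coset (rel_e L) u) + f (coset (rel_e L) v)) \<and>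
     (\<forall>b c gs. f (tsum (rel_e L) [(src L b \<cdot>\<^bsub>L\<^esub> tgt L c \<cdot>\<^bsub>L\<^esub> X, Y). (X, Y) \<leftarrow> gs])
               = b * f (tsum (rel_e L) gs) * c)}"

text \<open>\<open>f(X, Y)\<close> stands for \<open>f(X \<otimes> Y)\<close>.\<close>

definition app ::
  "('k::field, 'b, 'l::ab_group_add) bialgebroid_data
    \<Rightarrow> (('l \<times> 'l \<Rightarrow>\<^sub>0 'k) set \<Rightarrow> 'b) \<Rightarrow> 'l \<Rightarrow> 'l \<Rightarrow> 'b" where
  "app L f X Y = f (tsum (rel_e L) [(X, Y)])"

definition convolution ::
  "('k::field, 'b::{ring, monoid_mult}, 'l::ab_group_add) bialgebroid_data
    \<Rightarrow> (('l \<times> 'l \<Rightarrow>\<^sub>0 'k) set \<Rightarrow> 'b) \<Rightarrow> (('l \<times> 'l \<Rightarrow>\<^sub>0 'k) set \<Rightarrow> 'b)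
    \<Rightarrow> 'l \<Rightarrow> 'l \<Rightarrow> 'b" where
  "convolution L f g X Y =
     (\<Sum>(X1, X2)\<leftarrow>sw L X. \<Sum>(Y1, Y2)\<leftarrow>sw L Y. app L f X1 Y1 * app L g X2 Y2)"

definition convolution_unit ::
  "('k::field, 'b, 'l) bialgebroid_data \<Rightarrow> 'l \<Rightarrow> 'l \<Rightarrow> 'b" where
  "convolution_unit L X Y = counit L (X \<cdot>\<^bsub>L\<^esub> Y)"

text \<open>Bimodule maps are determined by their values on pure tensors, so equality is tested there.\<close>

definition convolution_inverse ::
  "('k::field, 'b::{ring, monoid_mult}, 'l::ab_group_add) bialgebroid_data
    \<Rightarrow> (('l \<times> 'l \<Rightarrow>\<^sub>0 'k) set \<Rightarrow> 'b) \<Rightarrow> (('l \<times> 'l \<Rightarrow>\<^sub>0 'k) set \<Rightarrow> 'b) \<Rightarrow> bool" where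
  "convolution_inverse L f g \<longleftrightarrow>
     f \<in> bimodule_hom L \<and> g \<in> bimodule_hom L \<and>
     convolution L f g = convolution_unit L \<and> convolution L g f = convolution_unit L"

definition normalised ::
  "('k::field, 'b, 'l::ab_group_add) bialgebroid_data
    \<Rightarrow> (('l \<times> 'l \<Rightarrow>\<^sub>0 'k) set \<Rightarrow> 'b) \<Rightarrow> bool" where
  "normalised L f \<longleftrightarrow>
     (\<forall>X. app L f \<one>\<^bsub>L\<^esub> X = counit L X \<and> app L f X \<one>\<^bsub>L\<^esub> = counit L X)"

definition left_2_cocycle ::
  "('k::field, 'b::{ring, monoid_mult}, 'l::ab_group_add) bialgebroid_data
    \<Rightarrow> (('l \<times> 'l \<Rightarrow>\<^sub>0 'k) set \<Rightarrow> 'b) \<Rightarrow> bool" where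
  "left_2_cocycle L f \<longleftrightarrow>
     f \<in> bimodule_hom L \<and> (\<exists>g. convolution_inverse L f g) \<and>
     (\<forall>X Y Z.
        app L f X (\<Sum>(Y1, Y2)\<leftarrow>sw L Y. \<Sum>(Z1, Z2)\<leftarrow>sw L Z.
                     src L (app L f Y1 Z1) \<cdot>\<^bsub>L\<^esub> Y2 \<cdot>\<^bsub>L\<^esub> Z2)
      = app L f (\<Sum>(X1, X2)\<leftarrow>sw L X. \<Sum>(Y1, Y2)\<leftarrow>sw L Y.
                   src L (app L f X1 Y1) \<cdot>\<^bsub>L\<^esub> X2 \<cdot>\<^bsub>L\<^esub> Y2) Z) \<and>
     normalised L f"

definition right_2_cocycle ::
  "('k::field, 'b::{ring, monoid_mult}, 'l::ab_group_add) bialgebroid_data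
    \<Rightarrow> (('l \<times> 'l \<Rightarrow>\<^sub>0 'k) set \<Rightarrow> 'b) \<Rightarrow> bool" where
  "right_2_cocycle L f \<longleftrightarrow>
     f \<in> bimodule_hom L \<and> (\<exists>g. convolution_inverse L f g) \<and>
     (\<forall>X Y Z.
        app L f X (\<Sum>(Y1, Y2)\<leftarrow>sw L Y. \<Sum>(Z1, Z2)\<leftarrow>sw L Z.
                     tgt L (app L f Y2 Z2) \<cdot>\<^bsub>L\<^esub> Y1 \<cdot>\<^bsub>L\<^esub> Z1)
      = app L f (\<Sum>(X1, X2)\<leftarrow>sw L X. \<Sum>(Y1, Y2)\<leftarrow>sw L Y.
                   tgt L (app L f X2 Y2) \<cdot>\<^bsub>L\<^esub> X1 \<cdot>\<^bsub>L\<^esub> Y1) Z) \<and>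
     normalised L f"

text \<open>\<open>g\<close> is the convolution inverse of the cocycle \<open>f\<close>; it is unique as a map on the tensor product.\<close>

definition invertible_2_cocycle ::
  "('k::field, 'b::{ring, monoid_mult}, 'l::ab_group_add) bialgebroid_data
    \<Rightarrow> (('l \<times> 'l \<Rightarrow>\<^sub>0 'k) set \<Rightarrow> 'b) \<Rightarrow> (('l \<times> 'l \<Rightarrow>\<^sub>0 'k) set \<Rightarrow> 'b) \<Rightarrow> bool" where
  "invertible_2_cocycle L f g \<longleftrightarrow>
     left_2_cocycle L f \<and> convolution_inverse L f g \<and> right_2_cocycle L g"

definition twisted_product ::
  "('k::field, 'b, 'l::ab_group_add) bialgebroid_data
    \<Rightarrow> (('l \<times> 'l \<Rightarrow>\<^sub>0 'k) set \<Rightarrow> 'b) \<Rightarrow> (('l \<times> 'l \<Rightarrow>\<^sub>0 'k) set \<Rightarrow> 'b)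
    \<Rightarrow> 'l \<Rightarrow> 'l \<Rightarrow> 'l" where
  "twisted_product L f g X Y =
     (\<Sum>(X1, X2, X3)\<leftarrow>sw3 L X. \<Sum>(Y1, Y2, Y3)\<leftarrow>sw3 L Y.
        src L (app L f X1 Y1) \<cdot>\<^bsub>L\<^esub> tgt L (app L g X3 Y3) \<cdot>\<^bsub>L\<^esub> X2 \<cdot>\<^bsub>L\<^esub> Y2)"

definition twist ::
  "('k::field, 'b, 'l::ab_group_add) bialgebroid_data
    \<Rightarrow> (('l \<times> 'l \<Rightarrow>\<^sub>0 'k) set \<Rightarrow> 'b) \<Rightarrow> (('l \<times> 'l \<Rightarrow>\<^sub>0 'k) set \<Rightarrow> 'b)
    \<Rightarrow> ('k, 'b, 'l) bialgebroid_data" where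
  "twist L f g = L\<lparr>prd := twisted_product L f g\<rparr>"

end

theory Submission
  imports Defs
begin

text \<open>
  An identity between tensors holds as soon as every balanced function has equal sums over the two sides,
  so all computations are done with sums \<open>SW X f\<close> of balanced functions \<open>f\<close> over \<open>X\<^sub>(\<^sub>1\<^sub>) \<otimes> X\<^sub>(\<^sub>2\<^sub>)\<close>.

  Write \<open>\<tau>\<close> for the convolution inverse of \<open>\<sigma>\<close>, \<open>X \<circ> Y = s(\<sigma>(X\<^sub>1, Y\<^sub>1))X\<^sub>2Y\<^sub>2\<close> and \<open>X \<bullet> Y = t(\<tau>(X\<^sub>2, Y\<^sub>2))X\<^sub>1Y\<^sub>1\<close>.
  Twisting from the left and from the right are commuting actions of the convolution algebra, which gives
  \<open>X \<circ> Y = t(\<sigma>(X\<^sub>2, Y\<^sub>2))(X\<^sub>1 \<cdot>\<^sub>\<sigma> Y\<^sub>1)\<close>, \<open>X \<bullet> Y = s(\<tau>(X\<^sub>1, Y\<^sub>1))(X\<^sub>2 \<cdot>\<^sub>\<sigma> Y\<^sub>2)\<close> and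
  \<open>\<Delta>(X \<cdot>\<^sub>\<sigma> Y) = (X\<^sub>1 \<circ> Y\<^sub>1) \<otimes> (X\<^sub>2 \<bullet> Y\<^sub>2) = (X\<^sub>1 \<cdot>\<^sub>\<sigma> Y\<^sub>1) \<otimes> (X\<^sub>2 \<cdot>\<^sub>\<sigma> Y\<^sub>2)\<close>. Associativity of \<open>\<cdot>\<^sub>\<sigma>\<close> follows from the two
  cocycle identities.

  Put \<open>Z \<rightharpoonup> M = s(\<tau>(M\<^sub>1, Z))M\<^sub>2\<close>. The left cocycle identity implies
  \<open>P \<circ> (Z \<rightharpoonup> M) = s(\<sigma>(P\<^sub>1, M\<^sub>1Z\<^sub>1))(Z\<^sub>2 \<rightharpoonup> P\<^sub>2M\<^sub>2)\<close>. For \<open>P \<otimes> M = X\<^sub>+ \<otimes> X\<^sub>-\<close> one has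
  \<open>P\<^sub>1 \<otimes> M\<^sub>1 \<otimes> P\<^sub>2M\<^sub>2 = P \<otimes> M \<otimes> 1\<close>, so the right hand side collapses, and \<open>X\<^sub>1\<^sub>+ \<otimes> X\<^sub>1\<^sub>-X\<^sub>2 = X \<otimes> 1\<close> finishes both
  inverse identities.
\<close>

section \<open>Sums over representatives of tensors\<close>

lemma lookup_free_scale: "Poly_Mapping.lookup (free_scale c u) g = c * Poly_Mapping.lookup u g"
  by (simp add: free_scale_def Poly_Mapping.map.rep_eq when_def)

interpretation free: vector_space "free_scale :: 'k::field \<Rightarrow> ('g \<Rightarrow>\<^sub>0 'k) \<Rightarrow> ('g \<Rightarrow>\<^sub>0 'k)"
  by unfold_locales
    (auto intro!: poly_mapping_eqI simp: lookup_free_scale lookup_add algebra_simps)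

lemma free_scale_gen: "free_scale c (Poly_Mapping.single g a) = Poly_Mapping.single g (c * a)"
  by (auto intro!: poly_mapping_eqI simp: lookup_free_scale lookup_single when_def)

lemma coset_eq_iff: "coset R u = coset R v \<longleftrightarrow> u - v \<in> free.span R"
proof
  assume "coset R u = coset R v"
  moreover have "u \<in> coset R u" by (simp add: coset_def free.span_zero)
  ultimately show "u - v \<in> free.span R" by (auto simp: coset_def)
next
  assume *: "u - v \<in> free.span R"
  have "w - u \<in> free.span R \<longleftrightarrow> w - v \<in> free.span R" for w
    using free.span_add[OF _ *, of "w - u"] free.span_diff[OF _ *, of "w - v"] by auto
  then show "coset R u = coset R v" by (simp add: coset_def)
qed

section \<open>Descent of functions on generators to the quotient\<close>

text \<open>The coefficient is an argument of \<open>h\<close> because the target is only an abelian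
  group: \<open>h g c\<close> plays the part of \<open>c\<close> times the image of
  \<open>g\<close>.\<close>

definition lin_ext :: "('g \<Rightarrow> 'k::field \<Rightarrow> 'v::ab_group_add) \<Rightarrow> ('g \<Rightarrow>\<^sub>0 'k) \<Rightarrow> 'v" where
  "lin_ext h u = (\<Sum>g\<in>Poly_Mapping.keys u. h g (Poly_Mapping.lookup u g))"

context
  fixes h :: "'g \<Rightarrow> 'k::field \<Rightarrow> 'v::ab_group_add"
  assumes h_add: "\<And>g a b. h g (a + b) = h g a + h g b"
begin

lemma lin_ext_zero_coeff: "h g 0 = 0"
  using h_add[of g 0 0] by simp

lemma lin_ext_superset:
  assumes "finite A" "Poly_Mapping.keys u \<subseteq> A"
  shows "lin_ext h u = (\<Sum>g\<in>A. h g (Poly_Mapping.lookup u g))"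
  unfolding lin_ext_def using assms
  by (intro sum.mono_neutral_left) (auto simp: in_keys_iff lin_ext_zero_coeff)

lemma lin_ext_add: "lin_ext h (u + v) = lin_ext h u + lin_ext h v"
proof -
  let ?A = "Poly_Mapping.keys u \<union> Poly_Mapping.keys v"
  have "finite ?A" by simp
  moreover have "Poly_Mapping.keys (u + v) \<subseteq> ?A" by (rule Poly_Mapping.keys_add)
  ultimately show ?thesis
    by (simp add: lin_ext_superset[of ?A] lookup_add h_add sum.distrib)
qed

lemma lin_ext_zero: "lin_ext h 0 = 0"
  by (simp add: lin_ext_def)

lemma lin_ext_diff: "lin_ext h (u - v) = lin_ext h u - lin_ext h v"
  using lin_ext_add[of "u - v" v] by simp

lemma lin_ext_single: "lin_ext h (Poly_Mapping.single g c) = h g c"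
  by (simp add: lin_ext_superset[of "{g}"])

lemma lin_ext_sum_gen: "lin_ext h (\<Sum>g\<leftarrow>gs. gen g) = (\<Sum>g\<leftarrow>gs. h g 1)"
  by (induction gs) (simp_all add: lin_ext_zero lin_ext_add lin_ext_single)

text \<open>With no scalars on the target, vanishing is carried through the span together with all
  scalar multiples, hence the \<open>free_scale c r\<close> in the hypothesis.\<close>

lemma lin_ext_tsum:
  assumes R: "\<And>r c. r \<in> R \<Longrightarrow> lin_ext h (free_scale c r) = 0"
    and eq: "tsum R gs = tsum R gs'"
  shows "(\<Sum>g\<leftarrow>gs. h g 1) = (\<Sum>g\<leftarrow>gs'. h g 1)"
proof -
  have "u \<in> free.span R \<Longrightarrow> \<forall>c. lin_ext h (free_scale c u) = 0" for u
    by (induction rule: free.span_induct_alt)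
       (simp_all add: lin_ext_zero free.scale_right_distrib lin_ext_add R)
  moreover have "(\<Sum>g\<leftarrow>gs. gen g) - (\<Sum>g\<leftarrow>gs'. gen g) \<in> free.span R"
    using eq by (simp add: tsum_def coset_eq_iff)
  ultimately have "lin_ext h (free_scale 1 ((\<Sum>g\<leftarrow>gs. gen g) - (\<Sum>g\<leftarrow>gs'. gen g))) = 0"
    by blast
  then show ?thesis by (simp add: lin_ext_diff lin_ext_sum_gen)
qed

end

text \<open>
  Functionals on the free vector space separate a tensor from zero; this is why an identity between
  tensors only has to be tested on \<open>k\<close>-valued balanced functions.
\<close>

lemma separating_functional:
  fixes v :: "'g \<Rightarrow>\<^sub>0 'k::field"
  assumes "v \<notin> free.span R"
  obtains \<phi> where "Vector_Spaces.linear free_scale (*) \<phi>" "\<And>r. r \<in> R \<Longrightarrow> \<phi> r = 0" "\<phi> v = 1"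
proof -
  obtain C where C: "C \<subseteq> free.span R" "free.independent C" "free.span R \<subseteq> free.span C"
    using free.maximal_independent_subset[of "free.span R"] by blast
  interpret k: vector_space "(*) :: 'k \<Rightarrow> 'k \<Rightarrow> 'k"
    by unfold_locales (simp_all add: algebra_simps)
  interpret p: vector_space_pair "free_scale :: 'k \<Rightarrow> ('g \<Rightarrow>\<^sub>0 'k) \<Rightarrow> _" "(*) :: 'k \<Rightarrow> 'k \<Rightarrow> 'k" ..
  have vC: "v \<notin> free.span C"
    using assms C(1) free.span_minimal[OF C(1) free.subspace_span] by blast
  from p.linear_independent_extend[OF free.independent_insertI[OF vC C(2)], of "\<lambda>x. if x = v then 1 else 0"]
  obtain \<phi> where \<phi>: "Vector_Spaces.linear free_scale (*) \<phi>"
      "\<And>x. x \<in> insert v C \<Longrightarrow> \<phi> x = (if x = v then 1 else 0)"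
    by (elim exE conjE) blast
  have "\<phi> x = 0" if "x \<in> C" for x
    using \<phi>(2)[of x] that vC free.span_base[of x C] by auto
  then have "\<phi> x = 0" if "x \<in> free.span C" for x
    using p.linear_eq_0_on_span[OF \<phi>(1)] that by blast
  then have "\<phi> r = 0" if "r \<in> R" for r
    using C(3) free.span_base[OF that] by blast
  then show ?thesis using that \<phi> by auto
qed

section \<open>Balanced functions and equality of tensors\<close>

definition biadditive :: "('a::ab_group_add \<Rightarrow> 'c::ab_group_add \<Rightarrow> 'v::ab_group_add) \<Rightarrow> bool" where
  "biadditive f \<longleftrightarrow> (\<forall>x x' y. f (x + x') y = f x y + f x' y) \<and> (\<forall>x y y'. f x (y + y') = f x y + f x y')"

lemma tensor_rel_intros:
  "gen (x + x', y) - gen (x, y) - gen (x', y) \<in> tensor_rel scale ract lact"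
  "gen (x, y + y') - gen (x, y) - gen (x, y') \<in> tensor_rel scale ract lact"
  "gen (scale c x, y) - free_scale c (gen (x, y)) \<in> tensor_rel scale ract lact"
  "gen (x, scale c y) - free_scale c (gen (x, y)) \<in> tensor_rel scale ract lact"
  "gen (ract r x, y) - gen (x, lact r y) \<in> tensor_rel scale ract lact"
  unfolding tensor_rel_def by blast+

text \<open>A functional that kills the relations restricts on generators to a balanced function;
  the one from \<open>separating_functional\<close> would tell two distinct tensors apart.\<close>

lemma tensor_rel_separate:
  fixes scale :: "'k::field \<Rightarrow> 'a::ab_group_add \<Rightarrow> 'a"
  assumes "\<And>f :: 'a \<Rightarrow> 'a \<Rightarrow> 'k. biadditive f \<Longrightarrow> (\<And>r x y. f (ract r x) y = f x (lact r y)) \<Longrightarrow>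
     (\<Sum>(x, y)\<leftarrow>gs. f x y) = (\<Sum>(x, y)\<leftarrow>gs'. f x y)"
  shows "tsum (tensor_rel scale ract lact) gs = tsum (tensor_rel scale ract lact) gs'"
proof (rule ccontr)
  let ?R = "tensor_rel scale ract lact"
  assume "\<not> ?thesis"
  then have "(\<Sum>g\<leftarrow>gs. gen g) - (\<Sum>g\<leftarrow>gs'. gen g) \<notin> free.span ?R"
    by (simp add: tsum_def coset_eq_iff)
  then obtain \<phi> where lin: "Vector_Spaces.linear free_scale (*) \<phi>"
    and R: "\<And>r. r \<in> ?R \<Longrightarrow> \<phi> r = 0"
    and 1: "\<phi> ((\<Sum>g\<leftarrow>gs. gen g) - (\<Sum>g\<leftarrow>gs'. gen g)) = 1"
    by (rule separating_functional) blast
  interpret \<phi>: Vector_Spaces.linear free_scale "(*)" \<phi> by (rule lin)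
  let ?f = "\<lambda>x y. \<phi> (gen (x, y))"
  have "\<phi> (gen (x + x', y) - gen (x, y) - gen (x', y)) = 0" for x x' y
    by (rule R) (rule tensor_rel_intros)
  moreover have "\<phi> (gen (x, y + y') - gen (x, y) - gen (x, y')) = 0" for x y y'
    by (rule R) (rule tensor_rel_intros)
  moreover have "\<phi> (gen (ract r x, y) - gen (x, lact r y)) = 0" for r x y
    by (rule R) (rule tensor_rel_intros)
  ultimately have "(\<Sum>(x, y)\<leftarrow>gs. ?f x y) = (\<Sum>(x, y)\<leftarrow>gs'. ?f x y)"
    by (intro assms) (auto simp: biadditive_def \<phi>.diff diff_diff_eq \<phi>.add)
  moreover have "\<phi> (\<Sum>g\<leftarrow>hs. gen g) = (\<Sum>(x, y)\<leftarrow>hs. ?f x y)" for hs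
    by (induction hs) (auto simp: \<phi>.add \<phi>.zero)
  ultimately show False using 1 by (simp add: \<phi>.diff)
qed

lemma tensor_rel_sum_eq:
  fixes scale :: "'k::field \<Rightarrow> 'a::ab_group_add \<Rightarrow> 'a" and f :: "'a \<Rightarrow> 'a \<Rightarrow> 'v::ab_group_add"
  assumes vs: "vector_space scale" and f: "biadditive f" "\<And>r x y. f (ract r x) y = f x (lact r y)"
    and sc: "\<And>c x y. f (scale c x) y = f x (scale c y)"
    and lact: "\<And>c r y. lact r (scale c y) = scale c (lact r y)"
    and eq: "tsum (tensor_rel scale ract lact) gs = tsum (tensor_rel scale ract lact) gs'"
  shows "(\<Sum>(x, y)\<leftarrow>gs. f x y) = (\<Sum>(x, y)\<leftarrow>gs'. f x y)"
proof -
  interpret vector_space scale by (rule vs)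
  \<comment> \<open>The coefficient is absorbed in the first factor, which \<open>sc\<close> makes
    compatible with scaling the second.\<close>
  let ?h = "\<lambda>(x, y) c. f (scale c x) y"
  have add: "?h g (a + b) = ?h g a + ?h g b" for g a b
    using f(1) by (auto simp: biadditive_def scale_left_distrib split: prod.split)
  have "(\<Sum>g\<leftarrow>gs. ?h g 1) = (\<Sum>g\<leftarrow>gs'. ?h g 1)"
  proof (rule lin_ext_tsum[of ?h, OF add _ eq])
    fix r c assume r: "r \<in> tensor_rel scale ract lact"
    note [simp] = lin_ext_diff[of ?h, OF add] lin_ext_single[of ?h, OF add] free_scale_gen
       free.scale_right_diff_distrib scale_right_distrib
    have [simp]: "f (x + x') y = f x y + f x' y" "f x (y + y') = f x y + f x y'" for x x' y y'
      using f(1) by (auto simp: biadditive_def)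
    have [simp]: "f (scale c (ract r x)) y = f (scale c x) (lact r y)" for c r x y
      by (simp only: sc f(2) lact)
    show "lin_ext ?h (free_scale c r) = 0"
      using r by (auto simp: tensor_rel_def mult.commute sc[symmetric])
  qed
  then show ?thesis by (simp add: case_prod_unfold)
qed


lemma tensor3_rel_sum_eq:
  fixes scale :: "'k::field \<Rightarrow> 'a::ab_group_add \<Rightarrow> 'a" and f :: "'a \<Rightarrow> 'a \<Rightarrow> 'a \<Rightarrow> 'v::ab_group_add"
  assumes vs: "vector_space scale"
    and f: "\<And>z. biadditive (\<lambda>x y. f x y z)" "\<And>x. biadditive (f x)"
      "\<And>r x y z. f (ract r x) y z = f x (lact r y) z" "\<And>r x y z. f x (ract r y) z = f x y (lact r z)"
    and sc: "\<And>c x y z. f (scale c x) y z = f x (scale c y) z" "\<And>c x y z. f x (scale c y) z = f x y (scale c z)"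
    and lact: "\<And>c r y. lact r (scale c y) = scale c (lact r y)"
    and eq: "tsum (tensor3_rel scale ract lact) gs = tsum (tensor3_rel scale ract lact) gs'"
  shows "(\<Sum>(x, y, z)\<leftarrow>gs. f x y z) = (\<Sum>(x, y, z)\<leftarrow>gs'. f x y z)"
proof -
  interpret vector_space scale by (rule vs)
  let ?h = "\<lambda>(x, y, z) c. f (scale c x) y z"
  have fadd [simp]: "f (x + x') y z = f x y z + f x' y z" "f x (y + y') z = f x y z + f x y' z"
     "f x y (z + z') = f x y z + f x y z'" for x x' y y' z z'
    using f(1)[of z] f(2)[of x] by (simp_all add: biadditive_def)
  have add: "?h g (a + b) = ?h g a + ?h g b" for g a b
    by (auto simp: scale_left_distrib split: prod.split)
  have "(\<Sum>g\<leftarrow>gs. ?h g 1) = (\<Sum>g\<leftarrow>gs'. ?h g 1)"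
  proof (rule lin_ext_tsum[of ?h, OF add _ eq])
    fix r c assume r: "r \<in> tensor3_rel scale ract lact"
    note [simp] = lin_ext_diff[of ?h, OF add] lin_ext_single[of ?h, OF add] free_scale_gen
       free.scale_right_diff_distrib scale_right_distrib
    have [simp]: "f (scale c (ract r x)) y z = f (scale c x) (lact r y) z" for c r x y z
      by (simp only: sc(1) f(3) lact)
    have [simp]: "f (scale c x) (ract r y) z = f (scale c x) y (lact r z)" for c r x y z
      by (simp only: f(4))
    show "lin_ext ?h (free_scale c r) = 0"
      using r by (auto simp: tensor3_rel_def mult.commute sc[symmetric])
  qed
  then show ?thesis by (simp add: case_prod_unfold)
qed

lemma tsum_in: "tsum R gs \<in> tensor_space R"
  by (simp add: tsum_def tensor_space_def)

text \<open>The choice in \<open>summands\<close> is justified since every formal combination is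
  congruent to a plain list of pure tensors: a coefficient moves into the first factor by the
  scaling relation.\<close>

lemma tsum_summands:
  fixes scale :: "'k::field \<Rightarrow> 'a::ab_group_add \<Rightarrow> 'a"
  assumes "z \<in> tensor_space (tensor_rel scale ract lact)"
  shows "tsum (tensor_rel scale ract lact) (summands (tensor_rel scale ract lact) z) = z"
proof -
  let ?R = "tensor_rel scale ract lact"
  have "\<exists>gs. tsum ?R gs = coset ?R u" for u
  proof (induction u rule: Poly_Mapping.update_induct)
    case const
    have "tsum ?R [] = coset ?R 0" by (simp add: tsum_def)
    then show ?case ..
  next
    case (update u g c)
    then obtain gs where gs: "tsum ?R gs = coset ?R u" by blast
    obtain x y where g: "g = (x, y)" by (cases g)
    have eq: "Poly_Mapping.update g c u = Poly_Mapping.single g c + u"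
      using update by (auto intro!: poly_mapping_eqI
          simp: lookup_update lookup_add lookup_single when_def in_keys_iff)
    have "(\<Sum>g\<leftarrow>gs. gen g) - u \<in> free.span ?R"
      using gs by (simp add: tsum_def coset_eq_iff)
    with free.span_base[OF tensor_rel_intros(3)[of scale c x y ract lact]]
    have "(gen (scale c x, y) - free_scale c (gen (x, y))) + ((\<Sum>g\<leftarrow>gs. gen g) - u) \<in> free.span ?R"
      by (rule free.span_add)
    then have "tsum ?R ((scale c x, y) # gs) = coset ?R (Poly_Mapping.update g c u)"
      by (simp add: eq[unfolded g] g tsum_def coset_eq_iff free_scale_gen algebra_simps)
    then show ?case ..
  qed
  then have "\<exists>gs. tsum ?R gs = z" using assms by (auto simp: tensor_space_def)
  then show ?thesis unfolding summands_def by (rule someI_ex)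
qed

section \<open>Sweedler calculus in a left bialgebroid\<close>

lemma sum_list_concat_map:
  "(\<Sum>x\<leftarrow>concat (map k xs). h x) = (\<Sum>x\<leftarrow>xs. \<Sum>y\<leftarrow>k x. h y)"
  by (induction xs) simp_all

definition is_additive :: "('a::ab_group_add \<Rightarrow> 'v::ab_group_add) \<Rightarrow> bool" where
  "is_additive h \<longleftrightarrow> (\<forall>x y. h (x + y) = h x + h y)"

lemma additive_sum_list:
  assumes "is_additive h"
  shows "h (\<Sum>x\<leftarrow>xs. f x) = (\<Sum>x\<leftarrow>xs. h (f x))"
proof -
  have "h 0 = 0" using assms by (metis is_additive_def add_cancel_right_right)
  then show ?thesis using assms by (induction xs) (simp_all add: is_additive_def)
qed

lemma sum_list_swap:
  fixes f :: "'a \<Rightarrow> 'c \<Rightarrow> 'v::ab_group_add"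
  shows "(\<Sum>x\<leftarrow>xs. \<Sum>y\<leftarrow>ys. f x y) = (\<Sum>y\<leftarrow>ys. \<Sum>x\<leftarrow>xs. f x y)"
  by (induction xs) (simp_all add: sum_list_addf)

context left_bialgebroid
begin

abbreviation S where "S \<equiv> src L"
abbreviation T where "T \<equiv> tgt L"
abbreviation e where "e \<equiv> counit L"

lemma S_mult: "S (a * b) = S a \<cdot> S b" by (rule s.hom_mult)
lemma T_mult: "T (a * b) = T b \<cdot> T a" by (rule t.hom_mult)
lemma S_add: "S (a + b) = S a + S b" by (rule s.add)
lemma T_add: "T (a + b) = T a + T b" by (rule t.add)
lemma S_one: "S 1 = \<one>" by (rule s.hom_one)
lemma T_one: "T 1 = \<one>" by (rule t.hom_one)
lemma ST: "S b \<cdot> T c = T c \<cdot> S b" by (rule src_tgt_commute)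
lemma ST_left: "S b \<cdot> (T c \<cdot> X) = T c \<cdot> (S b \<cdot> X)"
  by (metis L.mult_assoc ST)
lemma scal_eq_S: "scal L c X = S (scaleB c 1) \<cdot> X"
  by (simp add: s.scale S_one L.mult_scale_left L.mult_one_left)
lemma scal_eq_T: "scal L c X = T (scaleB c 1) \<cdot> X"
  by (simp add: t.scale T_one L.mult_scale_left L.mult_one_left)
lemma scal_eq_rT: "scal L c X = X \<cdot> T (scaleB c 1)"
  by (simp add: t.scale T_one L.mult_scale_right L.mult_one_right)

lemmas alg_simps = L.mult_assoc L.mult_one_left L.mult_one_right L.mult_add_left L.mult_add_right
  S_mult T_mult S_add T_add S_one T_one ST ST_left

text \<open>
  \<open>balB\<close> and \<open>balO\<close> are the functions that factor through the tensor product over \<open>B\<close> and \<open>B\<^sup>o\<^sup>p\<close>.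
  Homogeneity over \<open>k\<close> need not be required, because \<open>k\<close> acts through \<open>B\<close>.
\<close>

definition balB :: "('l \<Rightarrow> 'l \<Rightarrow> 'v::ab_group_add) \<Rightarrow> bool" where
  "balB f \<longleftrightarrow> biadditive f \<and> (\<forall>b x y. f (T b \<cdot> x) y = f x (S b \<cdot> y))"

definition balO :: "('l \<Rightarrow> 'l \<Rightarrow> 'v::ab_group_add) \<Rightarrow> bool" where
  "balO f \<longleftrightarrow> biadditive f \<and> (\<forall>b x y. f (x \<cdot> T b) y = f x (T b \<cdot> y))"

lemma balBI:
  assumes "\<And>x x' y. f (x + x') y = f x y + f x' y" "\<And>x y y'. f x (y + y') = f x y + f x y'"
    "\<And>b x y. f (T b \<cdot> x) y = f x (S b \<cdot> y)"
  shows "balB f"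
  using assms by (simp add: balB_def biadditive_def)

lemma balOI:
  assumes "\<And>x x' y. f (x + x') y = f x y + f x' y" "\<And>x y y'. f x (y + y') = f x y + f x y'"
    "\<And>b x y. f (x \<cdot> T b) y = f x (T b \<cdot> y)"
  shows "balO f"
  using assms by (simp add: balO_def biadditive_def)

lemma balBD:
  assumes "balB f"
  shows "f (x + x') y = f x y + f x' y" "f x (y + y') = f x y + f x y'" "f (T b \<cdot> x) y = f x (S b \<cdot> y)"
  using assms by (simp_all add: balB_def biadditive_def)

lemma balOD:
  assumes "balO f"
  shows "f (x + x') y = f x y + f x' y" "f x (y + y') = f x y + f x y'" "f (x \<cdot> T b) y = f x (T b \<cdot> y)"
  using assms by (simp_all add: balO_def biadditive_def)

lemma tsum_B_sum:
  assumes "tsum (rel_B L) gs = tsum (rel_B L) gs'" "balB f"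
  shows "(\<Sum>(x, y)\<leftarrow>gs. f x y) = (\<Sum>(x, y)\<leftarrow>gs'. f x y)"
proof (rule tensor_rel_sum_eq[OF L.vector_space_axioms _ _ _ _ assms(1)[unfolded rel_B_def]])
  show "f (scal L c x) y = f x (scal L c y)" for c x y
    using balBD(3)[OF assms(2)] by (metis scal_eq_S scal_eq_T)
qed (use assms(2) in \<open>auto simp: balB_def L.mult_scale_right\<close>)

lemma tsum_op_sum:
  assumes "tsum (rel_op L) gs = tsum (rel_op L) gs'" "balO f"
  shows "(\<Sum>(x, y)\<leftarrow>gs. f x y) = (\<Sum>(x, y)\<leftarrow>gs'. f x y)"
proof (rule tensor_rel_sum_eq[OF L.vector_space_axioms _ _ _ _ assms(1)[unfolded rel_op_def]])
  show "f (scal L c x) y = f x (scal L c y)" for c x y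
    using balOD(3)[OF assms(2)] by (metis scal_eq_T scal_eq_rT)
qed (use assms(2) in \<open>auto simp: balO_def L.mult_scale_right\<close>)

lemma tsum_B_eqI:
  assumes "\<And>f :: 'l \<Rightarrow> 'l \<Rightarrow> 'k. balB f \<Longrightarrow> (\<Sum>(x, y)\<leftarrow>gs. f x y) = (\<Sum>(x, y)\<leftarrow>gs'. f x y)"
  shows "tsum (rel_B L) gs = tsum (rel_B L) gs'"
  unfolding rel_B_def by (rule tensor_rel_separate) (simp add: assms balB_def)

lemma tsum_op_eqI:
  assumes "\<And>f :: 'l \<Rightarrow> 'l \<Rightarrow> 'k. balO f \<Longrightarrow> (\<Sum>(x, y)\<leftarrow>gs. f x y) = (\<Sum>(x, y)\<leftarrow>gs'. f x y)"
  shows "tsum (rel_op L) gs = tsum (rel_op L) gs'"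
  unfolding rel_op_def by (rule tensor_rel_separate) (simp add: assms balO_def)

lemma tsum_summands_B: "z \<in> tensor_space (rel_B L) \<Longrightarrow> tsum (rel_B L) (summands (rel_B L) z) = z"
  unfolding rel_B_def by (rule tsum_summands)

lemma tsum_summands_op: "z \<in> tensor_space (rel_op L) \<Longrightarrow> tsum (rel_op L) (summands (rel_op L) z) = z"
  unfolding rel_op_def by (rule tsum_summands)

section \<open>Sweedler sums and the coproduct laws\<close>

definition SW :: "'l \<Rightarrow> ('l \<Rightarrow> 'l \<Rightarrow> 'v::ab_group_add) \<Rightarrow> 'v" where
  "SW X f = (\<Sum>(x, y)\<leftarrow>sw L X. f x y)"

lemma tsum_sw: "tsum (rel_B L) (sw L X) = comult L X"
  unfolding sw_def by (rule tsum_summands_B) (rule comult_in)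

lemma SW_eq:
  assumes "comult L X = tsum (rel_B L) gs" "balB f"
  shows "SW X f = (\<Sum>(x, y)\<leftarrow>gs. f x y)"
  unfolding SW_def using assms by (intro tsum_B_sum) (simp_all add: tsum_sw)

lemma SW_addf: "SW X (\<lambda>x y. f x y + g x y) = SW X f + SW X g"
  by (simp add: SW_def sum_list_addf case_prod_unfold)

lemma SW_swap: "SW X (\<lambda>x x'. SW Y (\<lambda>y y'. f x x' y y')) = SW Y (\<lambda>y y'. SW X (\<lambda>x x'. f x x' y y'))"
  unfolding SW_def case_prod_unfold by (rule sum_list_swap)

lemma SW_push: "is_additive h \<Longrightarrow> h (SW X f) = SW X (\<lambda>x y. h (f x y))"
  by (simp add: SW_def additive_sum_list case_prod_unfold)

lemma SW_mult_left: "z \<cdot> SW X f = SW X (\<lambda>x y. z \<cdot> f x y)"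
  by (rule SW_push) (simp add: is_additive_def L.mult_add_right)
lemma SW_mult_right: "SW X f \<cdot> z = SW X (\<lambda>x y. f x y \<cdot> z)"
  by (rule SW_push) (simp add: is_additive_def L.mult_add_left)
lemma S_SW: "S (SW X f) = SW X (\<lambda>x y. S (f x y))"
  by (rule SW_push) (simp add: is_additive_def S_add)
lemma T_SW: "T (SW X f) = SW X (\<lambda>x y. T (f x y))"
  by (rule SW_push) (simp add: is_additive_def T_add)
lemma times_SW: "(b :: 'b) * SW X f = SW X (\<lambda>x y. b * f x y)"
  by (rule SW_push) (simp add: is_additive_def distrib_left)
lemma SW_times: "SW X f * (b :: 'b) = SW X (\<lambda>x y. f x y * b)"
  by (rule SW_push) (simp add: is_additive_def distrib_right)
lemma counit_SW: "e (SW X f) = SW X (\<lambda>x y. e (f x y))"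
  by (rule SW_push) (simp add: is_additive_def counit_add)

lemmas SW_push_simps = SW_mult_left SW_mult_right S_SW T_SW times_SW SW_times counit_SW

lemma SW_add: "balB f \<Longrightarrow> SW (X + Y) f = SW X f + SW Y f"
  by (simp add: SW_eq[OF comult_add]) (simp add: SW_def)

lemma SW_ST: "balB f \<Longrightarrow> SW (S b \<cdot> T c \<cdot> X) f = SW X (\<lambda>x y. f (S b \<cdot> x) (T c \<cdot> y))"
  by (simp add: SW_eq[OF comult_bimodule]) (simp add: SW_def sum_list_concat_map case_prod_unfold comp_def)

lemma SW_S: "balB f \<Longrightarrow> SW (S b \<cdot> X) f = SW X (\<lambda>x y. f (S b \<cdot> x) y)"
  using SW_ST[of f b 1 X] by (simp add: alg_simps)

lemma SW_T: "balB f \<Longrightarrow> SW (T b \<cdot> X) f = SW X (\<lambda>x y. f x (T b \<cdot> y))"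
  using SW_ST[of f 1 b X] by (simp add: alg_simps)

lemma SW_one: "balB f \<Longrightarrow> SW \<one> f = f \<one> \<one>"
  by (simp add: SW_eq[OF comult_one])

lemma SW_mult: "balB f \<Longrightarrow> SW (X \<cdot> Y) f = SW X (\<lambda>x x'. SW Y (\<lambda>y y'. f (x \<cdot> y) (x' \<cdot> y')))"
  by (simp add: SW_eq[OF comult_mult]) (simp add: SW_def sum_list_concat_map case_prod_unfold comp_def)

lemma SW_Sb: "balB f \<Longrightarrow> SW (S b) f = f (S b) \<one>"
  using SW_S[of f b \<one>] SW_one[of "\<lambda>x y. f (S b \<cdot> x) y"]
  by (simp add: balB_def biadditive_def alg_simps)

lemma SW_Tb: "balB f \<Longrightarrow> SW (T b) f = f \<one> (T b)"
  using SW_T[of f b \<one>] SW_one[of "\<lambda>x y. f x (T b \<cdot> y)"]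
  by (simp add: balB_def biadditive_def alg_simps)

lemma balB_mult: "balB f \<Longrightarrow> balB (\<lambda>x y. f (x \<cdot> a) (y \<cdot> a'))"
  by (simp add: balB_def biadditive_def alg_simps)

text \<open>Takeuchi membership provides some list \<open>gs\<close> with this property, not the
  chosen list \<open>sw L X\<close>. Right multiplication by fixed elements preserves balance, so
  both sums may be computed over \<open>gs\<close>.\<close>

lemma SW_tak:
  assumes "balB f"
  shows "SW X (\<lambda>x y. f (x \<cdot> T b) y) = SW X (\<lambda>x y. f x (y \<cdot> S b))"
proof -
  obtain gs where gs: "comult L X = tsum (rel_B L) gs"
    and "tsum (rel_B L) [(X \<cdot> tgt L b, Y). (X, Y) \<leftarrow> gs] = tsum (rel_B L) [(X, Y \<cdot> src L b). (X, Y) \<leftarrow> gs]"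
    using comult_takeuchi[of X] by (auto simp: takeuchi_def)
  from tsum_B_sum[OF this(2) assms]
  have *: "(\<Sum>(x, y)\<leftarrow>gs. f (x \<cdot> T b) y) = (\<Sum>(x, y)\<leftarrow>gs. f x (y \<cdot> S b))"
    by (simp add: sum_list_concat_map case_prod_unfold comp_def)
  have "SW X (\<lambda>x y. f (x \<cdot> T b) y) = (\<Sum>(x, y)\<leftarrow>gs. f (x \<cdot> T b) y)"
    using balB_mult[OF assms, of "T b" \<one>] by (intro SW_eq gs) (simp add: alg_simps)
  also have "\<dots> = (\<Sum>(x, y)\<leftarrow>gs. f x (y \<cdot> S b))" by (rule *)
  also have "\<dots> = SW X (\<lambda>x y. f x (y \<cdot> S b))"
    using balB_mult[OF assms, of \<one> "S b"] by (intro SW_eq[symmetric] gs) (simp add: alg_simps)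
  finally show ?thesis .
qed

lemma SW_cong: "(\<And>x y. f x y = g x y) \<Longrightarrow> SW X f = SW X g"
  by (metis ext)

text \<open>Factorwise multiplication by \<Delta>(X) respects the balancing because \<Delta>(X) lies
  in the Takeuchi product.\<close>

lemma balB_SW_mult:
  assumes f: "balB f"
  shows "balB (\<lambda>y y'. SW X (\<lambda>x x'. f (x \<cdot> y) (x' \<cdot> y')))"
proof (rule balBI)
  show "SW X (\<lambda>x x'. f (x \<cdot> (T b \<cdot> y)) (x' \<cdot> y')) = SW X (\<lambda>x x'. f (x \<cdot> y) (x' \<cdot> (S b \<cdot> y')))" for b y y'
    using SW_tak[OF balB_mult[OF f, of y y'], of X b] by (simp add: alg_simps)
qed (simp_all add: alg_simps balBD[OF f] SW_addf)

lemma SW_rS: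
  assumes f: "balB f"
  shows "SW (X \<cdot> S b) f = SW X (\<lambda>x y. f (x \<cdot> S b) y)"
  using SW_Sb[OF balB_SW_mult[OF f, of X], of b]
  by (simp add: SW_mult[OF f] SW_swap[of X "S b"] alg_simps)

lemma SW_rT:
  assumes f: "balB f"
  shows "SW (X \<cdot> T b) f = SW X (\<lambda>x y. f x (y \<cdot> T b))"
  using SW_Tb[OF balB_SW_mult[OF f, of X], of b]
  by (simp add: SW_mult[OF f] SW_swap[of X "T b"] alg_simps)

lemma SW_counit_left: "SW X (\<lambda>x y. S (e x) \<cdot> y) = X"
  using counit_left by (simp add: SW_def)

lemma SW_counit_right: "SW X (\<lambda>x y. T (e y) \<cdot> x) = X"
  using counit_right by (simp add: SW_def)

lemma SW_coassoc:
  assumes "\<And>z. balB (\<lambda>x y. F x y z)" "\<And>x. balB (F x)"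
  shows "SW X (\<lambda>x z. SW x (\<lambda>x y. F x y z)) = SW X (\<lambda>x y. SW y (\<lambda>y z. F x y z))"
proof -
  have sc: "F (scal L c x) y z = F x (scal L c y) z" "F x (scal L c y) z = F x y (scal L c z)" for c x y z
    using balBD(3)[OF assms(1)] balBD(3)[OF assms(2)] by (metis scal_eq_S scal_eq_T)+
  note coassoc[of X, unfolded rel_BB_def]
  from tensor3_rel_sum_eq[where f = F, OF L.vector_space_axioms _ _ _ _ sc _ this]
  have "(\<Sum>(x, y, z)\<leftarrow>[(X1, X2, X3). (X', X3) \<leftarrow> sw L X, (X1, X2) \<leftarrow> sw L X']. F x y z)
    = (\<Sum>(x, y, z)\<leftarrow>[(X1, X2, X3). (X1, X') \<leftarrow> sw L X, (X2, X3) \<leftarrow> sw L X']. F x y z)"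
    using assms by (simp add: balB_def L.mult_scale_right)
  then show ?thesis by (simp add: SW_def sum_list_concat_map case_prod_unfold comp_def)
qed

lemma counit_S: "e (S b \<cdot> X) = b * e X" by (rule counit_src)
lemma counit_T: "e (T b \<cdot> X) = e X * b"
  using counit_bimodule[of 1 b X] by (simp add: alg_simps)
text \<open>Both counit axioms are read at \<open>Y = S b\<close>, where
  \<open>e (S b) = b\<close>.\<close>

lemma counit_rT_rS: "e (X \<cdot> T b) = e (X \<cdot> S b)"
  using counit_mult_src[of X "S b"] counit_mult_tgt[of X "S b"] counit_S[of b \<one>]
  by (simp add: counit_one L.mult_one_right)

section \<open>Sweedler sums over two arguments\<close>

definition SW2 :: "'l \<Rightarrow> 'l \<Rightarrow> ('l \<Rightarrow> 'l \<Rightarrow> 'l \<Rightarrow> 'l \<Rightarrow> 'v::ab_group_add) \<Rightarrow> 'v" where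
  "SW2 X Y F = SW X (\<lambda>x x'. SW Y (\<lambda>y y'. F x y x' y'))"

text \<open>
  The weakest conditions under which \<open>SW2 X Y F\<close> is independent of the chosen representatives: for fixed
  \<open>x, x'\<close> the function of \<open>y, y'\<close> is in general not balanced, and becomes so only after summation over
  \<open>X\<close>, by the Takeuchi property.
\<close>

definition bal2 :: "('l \<Rightarrow> 'l \<Rightarrow> 'l \<Rightarrow> 'l \<Rightarrow> 'v::ab_group_add) \<Rightarrow> bool" where
  "bal2 F \<longleftrightarrow> (\<forall>y y'. balB (\<lambda>x x'. F x y x' y')) \<and> (\<forall>x x'. biadditive (\<lambda>y y'. F x y x' y'))
    \<and> (\<forall>b x y x' y'. F x (T b \<cdot> y) x' y' = F (x \<cdot> T b) y x' y')
    \<and> (\<forall>b x y x' y'. F x y x' (S b \<cdot> y') = F x y (x' \<cdot> S b) y')"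

lemma SW2_eq: "SW2 X Y F = SW Y (\<lambda>y y'. SW X (\<lambda>x x'. F x y x' y'))"
  unfolding SW2_def by (rule SW_swap)

lemma bal2_fst: "bal2 F \<Longrightarrow> balB (\<lambda>x x'. SW Y (\<lambda>y y'. F x y x' y'))"
  by (simp add: bal2_def balB_def biadditive_def SW_def sum_list_addf case_prod_unfold)

lemma balB_SW: "(\<And>x x'. balB (G x x')) \<Longrightarrow> balB (\<lambda>y y'. SW X (\<lambda>x x'. G x x' y y'))"
  by (simp add: balB_def biadditive_def SW_def sum_list_addf case_prod_unfold)

lemma bal2_snd:
  assumes F: "bal2 F"
  shows "balB (\<lambda>y y'. SW X (\<lambda>x x'. F x y x' y'))"
proof (rule balBI)
  fix b y y'
  have "SW X (\<lambda>x x'. F x (T b \<cdot> y) x' y') = SW X (\<lambda>x x'. F (x \<cdot> T b) y x' y')"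
    using F by (simp add: bal2_def)
  also have "\<dots> = SW X (\<lambda>x x'. F x y (x' \<cdot> S b) y')"
    using F by (intro SW_tak) (simp add: bal2_def)
  also have "\<dots> = SW X (\<lambda>x x'. F x y x' (S b \<cdot> y'))"
    using F by (simp add: bal2_def)
  finally show "SW X (\<lambda>x x'. F x (T b \<cdot> y) x' y') = SW X (\<lambda>x x'. F x y x' (S b \<cdot> y'))" .
qed (use F in \<open>simp_all add: bal2_def biadditive_def SW_addf\<close>)

lemma SW2_add_left: "bal2 F \<Longrightarrow> SW2 (X + X') Y F = SW2 X Y F + SW2 X' Y F"
  by (simp add: SW2_def SW_add bal2_fst)
lemma SW2_add_right: "bal2 F \<Longrightarrow> SW2 X (Y + Y') F = SW2 X Y F + SW2 X Y' F"
  by (simp add: SW2_eq SW_add bal2_snd)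
lemma SW2_S_left: "bal2 F \<Longrightarrow> SW2 (S b \<cdot> X) Y F = SW2 X Y (\<lambda>x y x' y'. F (S b \<cdot> x) y x' y')"
  by (simp add: SW2_def SW_S bal2_fst)
lemma SW2_T_left: "bal2 F \<Longrightarrow> SW2 (T b \<cdot> X) Y F = SW2 X Y (\<lambda>x y x' y'. F x y (T b \<cdot> x') y')"
  by (simp add: SW2_def SW_T bal2_fst)
lemma SW2_S_right: "bal2 F \<Longrightarrow> SW2 X (S b \<cdot> Y) F = SW2 X Y (\<lambda>x y x' y'. F x (S b \<cdot> y) x' y')"
  by (simp add: SW2_eq SW_S bal2_snd)
lemma SW2_T_right: "bal2 F \<Longrightarrow> SW2 X (T b \<cdot> Y) F = SW2 X Y (\<lambda>x y x' y'. F x y x' (T b \<cdot> y'))"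
  by (simp add: SW2_eq SW_T bal2_snd)
lemma SW2_rS_left: "bal2 F \<Longrightarrow> SW2 (X \<cdot> S b) Y F = SW2 X Y (\<lambda>x y x' y'. F (x \<cdot> S b) y x' y')"
  by (simp add: SW2_def SW_rS bal2_fst)
lemma SW2_rT_left: "bal2 F \<Longrightarrow> SW2 (X \<cdot> T b) Y F = SW2 X Y (\<lambda>x y x' y'. F x y (x' \<cdot> T b) y')"
  by (simp add: SW2_def SW_rT bal2_fst)

lemma SW2_push: "is_additive h \<Longrightarrow> h (SW2 X Y F) = SW2 X Y (\<lambda>x y x' y'. h (F x y x' y'))"
  by (simp add: SW2_def SW_push)

text \<open>Coassociativity is applied in \<open>X\<close> with the y's frozen, then in
  \<open>Y\<close>. After summation over \<open>X\<close>, balance in \<open>y1, y2\<close> is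
  visible in one bracketing and balance in \<open>y2, y3\<close> in the other; \<open>eq\<close>
  identifies the two functions, so both hold at once.\<close>

lemma SW2_coassoc:
  assumes F12: "\<And>x3 y3. bal2 (\<lambda>x1 y1 x2 y2. F x1 y1 x2 y2 x3 y3)"
    and F23: "\<And>x1 y1. bal2 (\<lambda>x2 y2 x3 y3. F x1 y1 x2 y2 x3 y3)"
  shows "SW2 X Y (\<lambda>x y x3 y3. SW2 x y (\<lambda>x1 y1 x2 y2. F x1 y1 x2 y2 x3 y3))
    = SW2 X Y (\<lambda>x1 y1 x y. SW2 x y (\<lambda>x2 y2 x3 y3. F x1 y1 x2 y2 x3 y3))"
proof -
  let ?l = "\<lambda>y1 y2 y3. SW X (\<lambda>x x3. SW x (\<lambda>x1 x2. F x1 y1 x2 y2 x3 y3))"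
  let ?r = "\<lambda>y1 y2 y3. SW X (\<lambda>x1 x. SW x (\<lambda>x2 x3. F x1 y1 x2 y2 x3 y3))"
  have eq: "?l y1 y2 y3 = ?r y1 y2 y3" for y1 y2 y3
    by (intro SW_coassoc) (use F12 F23 in \<open>simp_all add: bal2_def\<close>)
  have "balB (\<lambda>y1 y2. ?l y1 y2 y3)" for y3
    by (intro balB_SW bal2_snd F12)
  then have "balB (\<lambda>y1 y2. ?r y1 y2 y3)" for y3
    by (simp only: eq)
  moreover have "balB (\<lambda>y2 y3. ?r y1 y2 y3)" for y1
    by (intro balB_SW bal2_snd F23)
  ultimately have *: "SW Y (\<lambda>y y3. SW y (\<lambda>y1 y2. ?r y1 y2 y3)) = SW Y (\<lambda>y1 y. SW y (\<lambda>y2 y3. ?r y1 y2 y3))"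
    by (intro SW_coassoc)
  have "SW2 X Y (\<lambda>x y x3 y3. SW2 x y (\<lambda>x1 y1 x2 y2. F x1 y1 x2 y2 x3 y3))
    = SW Y (\<lambda>y y3. SW y (\<lambda>y1 y2. ?l y1 y2 y3))"
    unfolding SW2_eq by (intro SW_cong SW_swap)
  also have "\<dots> = SW Y (\<lambda>y1 y. SW y (\<lambda>y2 y3. ?r y1 y2 y3))"
    by (simp only: eq *)
  also have "\<dots> = SW2 X Y (\<lambda>x1 y1 x y. SW2 x y (\<lambda>x2 y2 x3 y3. F x1 y1 x2 y2 x3 y3))"
    unfolding SW2_eq by (intro SW_cong SW_swap[symmetric])
  finally show ?thesis .
qed

text \<open>
  \<open>opm\<close> and \<open>form\<close>: bimodule maps from \<open>\<L> \<otimes> \<L>\<close> over \<open>B\<^sup>e\<close> to \<open>\<L>\<close> and to \<open>B\<close>, given on pure tensors.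
\<close>

definition opm :: "('l \<Rightarrow> 'l \<Rightarrow> 'l) \<Rightarrow> bool" where
  "opm m \<longleftrightarrow> biadditive m \<and> (\<forall>b X Y. m (S b \<cdot> X) Y = S b \<cdot> m X Y \<and> m (T b \<cdot> X) Y = T b \<cdot> m X Y
     \<and> m (X \<cdot> S b) Y = m X (S b \<cdot> Y) \<and> m (X \<cdot> T b) Y = m X (T b \<cdot> Y))"

definition form :: "('l \<Rightarrow> 'l \<Rightarrow> 'b) \<Rightarrow> bool" where
  "form \<phi> \<longleftrightarrow> biadditive \<phi> \<and> (\<forall>b X Y. \<phi> (S b \<cdot> X) Y = b * \<phi> X Y \<and> \<phi> (T b \<cdot> X) Y = \<phi> X Y * b
     \<and> \<phi> (X \<cdot> S b) Y = \<phi> X (S b \<cdot> Y) \<and> \<phi> (X \<cdot> T b) Y = \<phi> X (T b \<cdot> Y))"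

lemma opmD:
  assumes "opm m"
  shows "m (x + x') y = m x y + m x' y" "m x (y + y') = m x y + m x y'"
    "m (S b \<cdot> x) y = S b \<cdot> m x y" "m (T b \<cdot> x) y = T b \<cdot> m x y"
    "m (x \<cdot> S b) y = m x (S b \<cdot> y)" "m (x \<cdot> T b) y = m x (T b \<cdot> y)"
  using assms by (simp_all add: opm_def biadditive_def)

lemma formD:
  assumes "form \<phi>"
  shows "\<phi> (x + x') y = \<phi> x y + \<phi> x' y" "\<phi> x (y + y') = \<phi> x y + \<phi> x y'"
    "\<phi> (S b \<cdot> x) y = b * \<phi> x y" "\<phi> (T b \<cdot> x) y = \<phi> x y * b"
    "\<phi> (x \<cdot> S b) y = \<phi> x (S b \<cdot> y)" "\<phi> (x \<cdot> T b) y = \<phi> x (T b \<cdot> y)"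
  using assms by (simp_all add: form_def biadditive_def)

lemma opm_mult: "opm (\<cdot>)"
  by (simp add: opm_def biadditive_def alg_simps)

section \<open>Twisting bimodule operations by forms\<close>

definition left_twist :: "('l \<Rightarrow> 'l \<Rightarrow> 'b) \<Rightarrow> ('l \<Rightarrow> 'l \<Rightarrow> 'l) \<Rightarrow> 'l \<Rightarrow> 'l \<Rightarrow> 'l" where
  "left_twist \<phi> m X Y = SW2 X Y (\<lambda>x y x' y'. S (\<phi> x y) \<cdot> m x' y')"

definition right_twist :: "('l \<Rightarrow> 'l \<Rightarrow> 'l) \<Rightarrow> ('l \<Rightarrow> 'l \<Rightarrow> 'b) \<Rightarrow> 'l \<Rightarrow> 'l \<Rightarrow> 'l" where
  "right_twist m \<phi> X Y = SW2 X Y (\<lambda>x y x' y'. T (\<phi> x' y') \<cdot> m x y)"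

definition conv :: "('l \<Rightarrow> 'l \<Rightarrow> 'b) \<Rightarrow> ('l \<Rightarrow> 'l \<Rightarrow> 'b) \<Rightarrow> 'l \<Rightarrow> 'l \<Rightarrow> 'b" where
  "conv \<phi> \<psi> X Y = SW2 X Y (\<lambda>x y x' y'. \<phi> x y * \<psi> x' y')"

lemmas bal_defs = bal2_def balB_def biadditive_def

lemma bal2_left_twist: "form \<phi> \<Longrightarrow> opm m \<Longrightarrow> bal2 (\<lambda>x y x' y'. S (\<phi> x y) \<cdot> m x' y')"
  by (simp add: bal_defs alg_simps formD opmD)

lemma bal2_right_twist: "form \<phi> \<Longrightarrow> opm m \<Longrightarrow> bal2 (\<lambda>x y x' y'. T (\<phi> x' y') \<cdot> m x y)"
  by (simp add: bal_defs alg_simps formD opmD)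

lemmas SW2_simps = SW2_add_left SW2_add_right SW2_S_left SW2_T_left SW2_S_right SW2_T_right SW2_rS_left SW2_rT_left

lemma opm_left_twist: "form \<phi> \<Longrightarrow> opm m \<Longrightarrow> opm (left_twist \<phi> m)"
  unfolding opm_def[of "left_twist \<phi> m"] left_twist_def
  by (simp add: SW2_simps bal2_left_twist biadditive_def)
     (simp add: SW2_def formD opmD alg_simps SW_push_simps)

lemma opm_right_twist: "form \<phi> \<Longrightarrow> opm m \<Longrightarrow> opm (right_twist m \<phi>)"
  unfolding opm_def[of "right_twist m \<phi>"] right_twist_def
  by (simp add: SW2_simps bal2_right_twist biadditive_def)
     (simp add: SW2_def formD opmD alg_simps SW_push_simps)

lemma left_twist_left_twist:
  assumes "form \<phi>" "form \<psi>" "opm m"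
  shows "left_twist \<phi> (left_twist \<psi> m) X Y = left_twist (conv \<phi> \<psi>) m X Y"
proof -
  have "left_twist \<phi> (left_twist \<psi> m) X Y = SW2 X Y (\<lambda>x1 y1 x y. SW2 x y (\<lambda>x2 y2 x3 y3. S (\<phi> x1 y1) \<cdot> (S (\<psi> x2 y2) \<cdot> m x3 y3)))"
    by (simp add: left_twist_def SW2_def SW_push_simps)
  also have "\<dots> = SW2 X Y (\<lambda>x y x3 y3. SW2 x y (\<lambda>x1 y1 x2 y2. S (\<phi> x1 y1) \<cdot> (S (\<psi> x2 y2) \<cdot> m x3 y3)))"
    by (rule SW2_coassoc[symmetric]) (use assms in \<open>simp_all add: bal_defs alg_simps formD opmD\<close>)
  also have "\<dots> = left_twist (conv \<phi> \<psi>) m X Y"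
    by (simp add: left_twist_def conv_def SW2_def SW_push_simps alg_simps)
  finally show ?thesis .
qed

lemma right_twist_right_twist:
  assumes "form \<phi>" "form \<psi>" "opm m"
  shows "right_twist (right_twist m \<phi>) \<psi> X Y = right_twist m (conv \<phi> \<psi>) X Y"
proof -
  have "right_twist (right_twist m \<phi>) \<psi> X Y = SW2 X Y (\<lambda>x y x3 y3. SW2 x y (\<lambda>x1 y1 x2 y2. T (\<psi> x3 y3) \<cdot> (T (\<phi> x2 y2) \<cdot> m x1 y1)))"
    by (simp add: right_twist_def SW2_def SW_push_simps)
  also have "\<dots> = SW2 X Y (\<lambda>x1 y1 x y. SW2 x y (\<lambda>x2 y2 x3 y3. T (\<psi> x3 y3) \<cdot> (T (\<phi> x2 y2) \<cdot> m x1 y1)))"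
    by (rule SW2_coassoc) (use assms in \<open>simp_all add: bal_defs alg_simps formD opmD\<close>)
  also have "\<dots> = right_twist m (conv \<phi> \<psi>) X Y"
    by (simp add: right_twist_def conv_def SW2_def SW_push_simps alg_simps)
  finally show ?thesis .
qed

lemma left_twist_right_twist:
  assumes "form \<phi>" "form \<psi>" "opm m"
  shows "right_twist (left_twist \<phi> m) \<psi> X Y = left_twist \<phi> (right_twist m \<psi>) X Y"
proof -
  have "right_twist (left_twist \<phi> m) \<psi> X Y = SW2 X Y (\<lambda>x y x3 y3. SW2 x y (\<lambda>x1 y1 x2 y2. S (\<phi> x1 y1) \<cdot> (T (\<psi> x3 y3) \<cdot> m x2 y2)))"
    by (simp add: right_twist_def left_twist_def SW2_def SW_push_simps ST_left)
  also have "\<dots> = SW2 X Y (\<lambda>x1 y1 x y. SW2 x y (\<lambda>x2 y2 x3 y3. S (\<phi> x1 y1) \<cdot> (T (\<psi> x3 y3) \<cdot> m x2 y2)))"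
    by (rule SW2_coassoc) (use assms in \<open>simp_all add: bal_defs alg_simps formD opmD\<close>)
  also have "\<dots> = left_twist \<phi> (right_twist m \<psi>) X Y"
    by (simp add: right_twist_def left_twist_def SW2_def SW_push_simps)
  finally show ?thesis .
qed

text \<open>Write \<epsilon>(xy) as \<epsilon>(x t(\<epsilon>(y))). The Takeuchi property moves
  t(\<epsilon>(y)) to the right of x' as s(\<epsilon>(y)), balance of \<open>m\<close> moves it onto
  y', and the counit law applies in each argument.\<close>

lemma left_twist_counit:
  assumes m: "opm m"
  shows "left_twist (\<lambda>X Y. e (X \<cdot> Y)) m X Y = m X Y"
proof -
  have "left_twist (\<lambda>X Y. e (X \<cdot> Y)) m X Y = SW Y (\<lambda>y y'. SW X (\<lambda>x x'. S (e (x \<cdot> T (e y))) \<cdot> m x' y'))"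
    by (simp add: left_twist_def SW2_eq counit_mult_tgt)
  also have "\<dots> = SW Y (\<lambda>y y'. SW X (\<lambda>x x'. S (e x) \<cdot> m (x' \<cdot> S (e y)) y'))"
    by (intro SW_cong SW_tak) (use m in \<open>simp add: bal_defs alg_simps opmD counit_add counit_T\<close>)
  also have "\<dots> = SW X (\<lambda>x x'. SW Y (\<lambda>y y'. m (S (e x) \<cdot> x') (S (e y) \<cdot> y')))"
    by (subst SW_swap) (simp add: opmD[OF m])
  also have "\<dots> = SW X (\<lambda>x x'. m (S (e x) \<cdot> x') (SW Y (\<lambda>y y'. S (e y) \<cdot> y')))"
    by (intro SW_cong SW_push[symmetric]) (simp add: is_additive_def opmD[OF m] L.mult_add_right)
  also have "\<dots> = SW X (\<lambda>x x'. m (S (e x) \<cdot> x') Y)"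
    by (simp only: SW_counit_left)
  also have "\<dots> = m (SW X (\<lambda>x x'. S (e x) \<cdot> x')) Y"
    by (rule SW_push[symmetric, where h = "\<lambda>x. m x Y"]) (simp add: is_additive_def opmD[OF m])
  finally show ?thesis by (simp add: SW_counit_left)
qed

lemma right_twist_counit:
  assumes m: "opm m"
  shows "right_twist m (\<lambda>X Y. e (X \<cdot> Y)) X Y = m X Y"
proof -
  have "right_twist m (\<lambda>X Y. e (X \<cdot> Y)) X Y = SW Y (\<lambda>y y'. SW X (\<lambda>x x'. T (e (x' \<cdot> S (e y'))) \<cdot> m x y))"
    by (simp add: right_twist_def SW2_eq counit_mult_src)
  also have "\<dots> = SW Y (\<lambda>y y'. SW X (\<lambda>x x'. T (e x') \<cdot> m (x \<cdot> T (e y')) y))"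
    by (intro SW_cong SW_tak[symmetric]) (use m in \<open>simp add: bal_defs alg_simps opmD counit_add counit_S\<close>)
  also have "\<dots> = SW X (\<lambda>x x'. SW Y (\<lambda>y y'. m (T (e x') \<cdot> x) (T (e y') \<cdot> y)))"
    by (subst SW_swap) (simp add: opmD[OF m])
  also have "\<dots> = SW X (\<lambda>x x'. m (T (e x') \<cdot> x) (SW Y (\<lambda>y y'. T (e y') \<cdot> y)))"
    by (intro SW_cong SW_push[symmetric]) (simp add: is_additive_def opmD[OF m] L.mult_add_right)
  also have "\<dots> = SW X (\<lambda>x x'. m (T (e x') \<cdot> x) Y)"
    by (simp only: SW_counit_right)
  also have "\<dots> = m (SW X (\<lambda>x x'. T (e x') \<cdot> x)) Y"
    by (rule SW_push[symmetric, where h = "\<lambda>x. m x Y"]) (simp add: is_additive_def opmD[OF m])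
  finally show ?thesis by (simp add: SW_counit_right)
qed

text \<open>\<open>SWm\<close> says that the coproduct of \<open>m\<close> is \<open>m1\<close>
  tensor \<open>m2\<close>. As \<open>S\<close> acts on the first leg of a coproduct, a left twist
  lands in \<open>m1\<close> alone. With its mirror image \<open>SW_right_twist\<close> this gives
  the coproducts of the twisted products, starting from multiplicativity of \<Delta>.\<close>

lemma SW_left_twist:
  fixes f :: "'l \<Rightarrow> 'l \<Rightarrow> 'v::ab_group_add"
  assumes \<phi>: "form \<phi>" and m: "opm m1" "opm m2" and f: "balB f"
    and SWm: "\<And>(f :: 'l \<Rightarrow> 'l \<Rightarrow> 'v) X Y. balB f \<Longrightarrow> SW (m X Y) f = SW2 X Y (\<lambda>x y x' y'. f (m1 x y) (m2 x' y'))"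
  shows "SW (left_twist \<phi> m X Y) f = SW2 X Y (\<lambda>x y x' y'. f (left_twist \<phi> m1 x y) (m2 x' y'))"
proof -
  have add: "is_additive (\<lambda>X. SW X f)"
    using f by (simp add: is_additive_def SW_add)
  have bal: "balB (\<lambda>x y. f (S b \<cdot> x) y)" for b
    using f by (simp add: bal_defs alg_simps)
  have add': "is_additive (\<lambda>X. f X Y)" for Y
    using f by (simp add: is_additive_def bal_defs)
  have "SW (left_twist \<phi> m X Y) f = SW2 X Y (\<lambda>x1 y1 x y. SW2 x y (\<lambda>x2 y2 x3 y3. f (S (\<phi> x1 y1) \<cdot> m1 x2 y2) (m2 x3 y3)))"
    by (simp add: left_twist_def SW2_push[OF add] SW_S[OF f] SWm[OF bal])
  also have "\<dots> = SW2 X Y (\<lambda>x y x3 y3. SW2 x y (\<lambda>x1 y1 x2 y2. f (S (\<phi> x1 y1) \<cdot> m1 x2 y2) (m2 x3 y3)))"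
    by (rule SW2_coassoc[symmetric])
       (use \<phi> m f in \<open>simp_all add: bal_defs alg_simps formD opmD\<close>)
  also have "\<dots> = SW2 X Y (\<lambda>x y x' y'. f (left_twist \<phi> m1 x y) (m2 x' y'))"
    by (simp add: left_twist_def SW2_push[OF add'])
  finally show ?thesis .
qed

lemma SW_right_twist:
  fixes f :: "'l \<Rightarrow> 'l \<Rightarrow> 'v::ab_group_add"
  assumes \<phi>: "form \<phi>" and m: "opm m1" "opm m2" and f: "balB f"
    and SWm: "\<And>(f :: 'l \<Rightarrow> 'l \<Rightarrow> 'v) X Y. balB f \<Longrightarrow> SW (m X Y) f = SW2 X Y (\<lambda>x y x' y'. f (m1 x y) (m2 x' y'))"
  shows "SW (right_twist m \<phi> X Y) f = SW2 X Y (\<lambda>x y x' y'. f (m1 x y) (right_twist m2 \<phi> x' y'))"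
proof -
  have add: "is_additive (\<lambda>X. SW X f)"
    using f by (simp add: is_additive_def SW_add)
  have bal: "balB (\<lambda>x y. f x (T b \<cdot> y))" for b
    using f by (simp add: bal_defs alg_simps)
  have add': "is_additive (\<lambda>Y. f X Y)" for X
    using f by (simp add: is_additive_def bal_defs)
  have "SW (right_twist m \<phi> X Y) f = SW2 X Y (\<lambda>x y x3 y3. SW2 x y (\<lambda>x1 y1 x2 y2. f (m1 x1 y1) (T (\<phi> x3 y3) \<cdot> m2 x2 y2)))"
    by (simp add: right_twist_def SW2_push[OF add] SW_T[OF f] SWm[OF bal])
  also have "\<dots> = SW2 X Y (\<lambda>x1 y1 x y. SW2 x y (\<lambda>x2 y2 x3 y3. f (m1 x1 y1) (T (\<phi> x3 y3) \<cdot> m2 x2 y2)))"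
    by (rule SW2_coassoc)
       (use \<phi> m f in \<open>simp_all add: bal_defs alg_simps formD opmD\<close>)
  also have "\<dots> = SW2 X Y (\<lambda>x y x' y'. f (m1 x y) (right_twist m2 \<phi> x' y'))"
    by (simp add: right_twist_def SW2_push[OF add'])
  finally show ?thesis .
qed

text \<open>A form evaluated on the middle legs may be attached to either side of the tensor sign,
  as t(b) on the left or s(b) on the right.\<close>

lemma right_twist_left_twist_move:
  fixes f :: "'l \<Rightarrow> 'l \<Rightarrow> 'v::ab_group_add"
  assumes \<phi>: "form \<phi>" and m: "opm m1" "opm m2" and f: "balB f"
  shows "SW2 X Y (\<lambda>x y x' y'. f (right_twist m1 \<phi> x y) (m2 x' y')) = SW2 X Y (\<lambda>x y x' y'. f (m1 x y) (left_twist \<phi> m2 x' y'))"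
proof -
  have add: "is_additive (\<lambda>X. f X Y)" "is_additive (f Y)" for Y
    using f by (simp_all add: is_additive_def bal_defs)
  have "SW2 X Y (\<lambda>x y x' y'. f (right_twist m1 \<phi> x y) (m2 x' y'))
    = SW2 X Y (\<lambda>x y x3 y3. SW2 x y (\<lambda>x1 y1 x2 y2. f (T (\<phi> x2 y2) \<cdot> m1 x1 y1) (m2 x3 y3)))"
    by (simp add: right_twist_def SW2_push[OF add(1)])
  also have "\<dots> = SW2 X Y (\<lambda>x1 y1 x y. SW2 x y (\<lambda>x2 y2 x3 y3. f (T (\<phi> x2 y2) \<cdot> m1 x1 y1) (m2 x3 y3)))"
    by (rule SW2_coassoc) (use \<phi> m f in \<open>simp_all add: bal_defs alg_simps formD opmD\<close>)
  also have "\<dots> = SW2 X Y (\<lambda>x y x' y'. f (m1 x y) (left_twist \<phi> m2 x' y'))"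
    by (simp add: left_twist_def SW2_push[OF add(2)] balBD[OF f])
  finally show ?thesis .
qed

lemma conv_counit:
  assumes \<phi>: "form \<phi>"
  shows "conv \<phi> (\<lambda>X Y. e (X \<cdot> Y)) X Y = \<phi> X Y"
proof -
  have "conv \<phi> (\<lambda>X Y. e (X \<cdot> Y)) X Y = SW Y (\<lambda>y y'. SW X (\<lambda>x x'. \<phi> x y * e (x' \<cdot> S (e y'))))"
    by (simp add: conv_def SW2_eq counit_mult_src)
  also have "\<dots> = SW Y (\<lambda>y y'. SW X (\<lambda>x x'. \<phi> (x \<cdot> T (e y')) y * e x'))"
    by (intro SW_cong SW_tak[symmetric])
       (use \<phi> in \<open>simp add: bal_defs formD counit_add counit_S algebra_simps\<close>)
  also have "\<dots> = SW X (\<lambda>x x'. SW Y (\<lambda>y y'. \<phi> (T (e x') \<cdot> x) (T (e y') \<cdot> y)))"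
    by (subst SW_swap) (simp add: formD[OF \<phi>])
  also have "\<dots> = SW X (\<lambda>x x'. \<phi> (T (e x') \<cdot> x) (SW Y (\<lambda>y y'. T (e y') \<cdot> y)))"
    by (intro SW_cong SW_push[symmetric]) (simp add: is_additive_def formD[OF \<phi>] distrib_right)
  also have "\<dots> = SW X (\<lambda>x x'. \<phi> (T (e x') \<cdot> x) Y)"
    by (simp only: SW_counit_right)
  also have "\<dots> = \<phi> (SW X (\<lambda>x x'. T (e x') \<cdot> x)) Y"
    by (rule SW_push[symmetric, where h = "\<lambda>x. \<phi> x Y"]) (simp add: is_additive_def formD[OF \<phi>])
  finally show ?thesis by (simp add: SW_counit_right)
qed

lemma SW_mult2: "balB f \<Longrightarrow> SW (X \<cdot> Y) f = SW2 X Y (\<lambda>x y x' y'. f (x \<cdot> y) (x' \<cdot> y'))"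
  by (simp add: SW2_def SW_mult)

lemma tsum_e_add:
  "coset (rel_e L) (gen (x + x', y)) = coset (rel_e L) (gen (x, y) + gen (x', y))"
  "coset (rel_e L) (gen (x, y + y')) = coset (rel_e L) (gen (x, y) + gen (x, y'))"
  using tensor_rel_intros(1,2)[THEN free.span_base]
  by (simp_all add: coset_eq_iff rel_e_def diff_diff_eq[symmetric])

lemma tsum_e_bal: "tsum (rel_e L) [(x \<cdot> eta L b c, y)] = tsum (rel_e L) [(x, eta L b c \<cdot> y)]"
  using free.span_base[OF tensor_rel_intros(5)[where r = "(b, c)" and scale = "scal L" and x = x and y = y
      and ract = "\<lambda>(b, c) X. X \<cdot> eta L b c" and lact = "\<lambda>(b, c) X. eta L b c \<cdot> X"]]
  by (simp add: tsum_def coset_eq_iff rel_e_def)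

lemma form_app:
  assumes "f \<in> bimodule_hom L"
  shows "form (app L f)"
proof -
  have bal: "app L f (x \<cdot> eta L b c) y = app L f x (eta L b c \<cdot> y)" for b c x y
    by (simp add: app_def tsum_e_bal)
  have "f (tsum (rel_e L) [(S b \<cdot> T c \<cdot> X, Y). (X, Y) \<leftarrow> gs]) = b * f (tsum (rel_e L) gs) * c" for b c gs
    using assms by (simp add: bimodule_hom_def)
  from this[of _ _ "[(x, y)]" for x y]
  have act: "app L f (S b \<cdot> T c \<cdot> x) y = b * app L f x y * c" for b c x y
    by (simp add: app_def)
  show ?thesis
    unfolding form_def biadditive_def
    using assms bal[of _ _ 1] bal[of _ 1] act[of _ 1] act[of 1]
    by (simp add: app_def tsum_def tsum_e_add bimodule_hom_def eta_def S_one T_one L.mult_one_left L.mult_one_right)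
qed

lemma convolution_eq: "convolution L f g X Y = conv (app L f) (app L g) X Y"
  by (simp add: convolution_def conv_def SW2_def SW_def)

end

section \<open>The twisted bialgebroid\<close>

locale cocycle_bialgebroid = left_bialgebroid scaleB L
  for scaleB :: "'k::field \<Rightarrow> 'b::{ring, monoid_mult} \<Rightarrow> 'b"
    and L :: "('k, 'b, 'l::ab_group_add) bialgebroid_data" (structure) +
  fixes \<sigma> \<tau> :: "('l \<times> 'l \<Rightarrow>\<^sub>0 'k) set \<Rightarrow> 'b"
  assumes cocycle: "invertible_2_cocycle L \<sigma> \<tau>"
begin

section \<open>The products \<open>circ\<close>, \<open>bul\<close> and \<open>tw\<close> attached
  to the cocycle\<close>

abbreviation sg where "sg \<equiv> app L \<sigma>"
abbreviation ta where "ta \<equiv> app L \<tau>"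
text \<open>\<open>circ\<close>, \<open>bul\<close> and \<open>tw\<close> are
  \<open>\<circ>\<close>, \<open>\<bullet>\<close> and \<open>\<cdot>\<^sub>\<sigma>\<close> of the
  opening.\<close>

abbreviation circ where "circ \<equiv> left_twist sg (\<cdot>)"
abbreviation bul where "bul \<equiv> right_twist (\<cdot>) ta"
abbreviation tw where "tw \<equiv> right_twist circ ta"

lemma form_sg: "form sg" and form_ta: "form ta"
  using cocycle by (auto simp: invertible_2_cocycle_def left_2_cocycle_def right_2_cocycle_def intro!: form_app)

lemma conv_sg_ta: "conv sg ta = (\<lambda>X Y. e (X \<cdot> Y))" and conv_ta_sg: "conv ta sg = (\<lambda>X Y. e (X \<cdot> Y))"
  using cocycle unfolding invertible_2_cocycle_def convolution_inverse_def
  by (simp_all add: fun_eq_iff convolution_eq convolution_unit_def)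

lemma sg_one [simp]: "sg \<one> X = e X" "sg X \<one> = e X"
  and ta_one [simp]: "ta \<one> X = e X" "ta X \<one> = e X"
  using cocycle by (simp_all add: invertible_2_cocycle_def left_2_cocycle_def right_2_cocycle_def normalised_def)

lemmas opm_circ = opm_left_twist[OF form_sg opm_mult]
lemmas opm_bul = opm_right_twist[OF form_ta opm_mult]
lemmas opm_tw = opm_right_twist[OF form_ta opm_circ]

lemma circ_eq: "circ X Y = (\<Sum>(X1, X2)\<leftarrow>sw L X. \<Sum>(Y1, Y2)\<leftarrow>sw L Y. S (sg X1 Y1) \<cdot> X2 \<cdot> Y2)"
  by (simp add: left_twist_def SW2_def SW_def L.mult_assoc)

lemma bul_eq: "bul X Y = (\<Sum>(X1, X2)\<leftarrow>sw L X. \<Sum>(Y1, Y2)\<leftarrow>sw L Y. T (ta X2 Y2) \<cdot> X1 \<cdot> Y1)"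
  by (simp add: right_twist_def SW2_def SW_def L.mult_assoc)

lemma sg_cocycle: "sg X (circ Y Z) = sg (circ X Y) Z"
  using cocycle unfolding circ_eq by (simp add: invertible_2_cocycle_def left_2_cocycle_def)

lemma ta_cocycle: "ta X (bul Y Z) = ta (bul X Y) Z"
  using cocycle unfolding bul_eq by (simp add: invertible_2_cocycle_def right_2_cocycle_def)

lemma tw_eq_left_twist: "tw X Y = left_twist sg bul X Y"
  by (rule left_twist_right_twist[OF form_sg form_ta opm_mult])

text \<open>Right twisting by \<open>sg\<close> undoes right twisting by \<open>ta\<close>, because
  \<open>conv ta sg\<close> is the convolution unit.\<close>

lemma circ_eq_right_twist: "circ X Y = right_twist tw sg X Y"
  by (simp add: right_twist_right_twist[OF form_ta form_sg opm_circ] conv_ta_sg right_twist_counit[OF opm_circ])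

lemma bul_eq_left_twist: "bul X Y = left_twist ta tw X Y"
  unfolding tw_eq_left_twist by (simp add: left_twist_left_twist[OF form_ta form_sg opm_bul] conv_ta_sg left_twist_counit[OF opm_bul])

text \<open>\<open>sw3\<close> brackets as \<open>((X1, X2), X3)\<close>, so \<open>ta\<close> sees
  the outer coproduct and \<open>sg\<close> the inner one, exactly as in the nesting of
  \<open>tw\<close>; what remains is an exchange of sums.\<close>

lemma twisted_product_eq: "twisted_product L \<sigma> \<tau> = tw"
proof (intro ext)
  fix X Y
  have "twisted_product L \<sigma> \<tau> X Y = SW X (\<lambda>x x3. SW x (\<lambda>x1 x2. SW Y (\<lambda>y y3. SW y (\<lambda>y1 y2.
    T (ta x3 y3) \<cdot> (S (sg x1 y1) \<cdot> (x2 \<cdot> y2))))))"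
    by (simp add: twisted_product_def sw3_def SW_def sum_list_concat_map case_prod_unfold comp_def alg_simps)
  also have "\<dots> = SW X (\<lambda>x x3. SW Y (\<lambda>y y3. SW x (\<lambda>x1 x2. SW y (\<lambda>y1 y2.
    T (ta x3 y3) \<cdot> (S (sg x1 y1) \<cdot> (x2 \<cdot> y2))))))"
    by (intro SW_cong SW_swap)
  also have "\<dots> = tw X Y"
    by (simp add: right_twist_def left_twist_def SW2_def SW_push_simps)
  finally show "twisted_product L \<sigma> \<tau> X Y = tw X Y" .
qed

lemma circ_one: "circ \<one> X = X" "circ X \<one> = X"
proof -
  note b = bal2_left_twist[OF form_sg opm_mult]
  show "circ \<one> X = X"
    by (simp add: left_twist_def SW2_def SW_one[OF bal2_fst[OF b]] alg_simps SW_counit_left)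
  show "circ X \<one> = X"
    by (simp add: left_twist_def SW2_eq SW_one[OF bal2_snd[OF b]] alg_simps SW_counit_left)
qed

lemma tw_one: "tw \<one> X = X" "tw X \<one> = X"
proof -
  note b = bal2_right_twist[OF form_ta opm_circ]
  show "tw \<one> X = X"
    by (simp add: right_twist_def[of circ] SW2_def SW_one[OF bal2_fst[OF b]] circ_one SW_counit_right)
  show "tw X \<one> = X"
    by (simp add: right_twist_def[of circ] SW2_eq SW_one[OF bal2_snd[OF b]] circ_one SW_counit_right)
qed

text \<open>Normalisation makes \<open>\<one>\<close> a unit for \<open>tw\<close>, and
  \<open>tw\<close> is a balanced bimodule map, so products with elements of the base are unchanged.
  Hence the tensor relations and the Sweedler lists of the twist are those of
  \<open>L\<close>.\<close>

lemma tw_S: "tw (S b) X = S b \<cdot> X" "tw X (S b) = X \<cdot> S b"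
  using opmD(3)[OF opm_tw, of b \<one> X] opmD(5)[OF opm_tw, of X b \<one>] by (simp_all add: tw_one alg_simps)

lemma tw_T: "tw (T b) X = T b \<cdot> X" "tw X (T b) = X \<cdot> T b"
  using opmD(4)[OF opm_tw, of b \<one> X] opmD(6)[OF opm_tw, of X b \<one>] by (simp_all add: tw_one alg_simps)

lemma tw_ST: "tw (S b \<cdot> T c) X = S b \<cdot> T c \<cdot> X"
  by (simp add: opmD(3)[OF opm_tw] tw_T L.mult_assoc)

lemma SW_circ: "balB f \<Longrightarrow> SW (circ X Y) f = SW2 X Y (\<lambda>x y x' y'. f (circ x y) (x' \<cdot> y'))"
  by (rule SW_left_twist[OF form_sg opm_mult opm_mult]) (simp_all add: SW_mult2)

lemma SW_tw': "balB f \<Longrightarrow> SW (tw X Y) f = SW2 X Y (\<lambda>x y x' y'. f (circ x y) (bul x' y'))"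
  by (rule SW_right_twist[OF form_ta opm_circ opm_mult]) (simp_all add: SW_circ)

text \<open>In \<Delta> = \<open>circ\<close> tensor \<open>bul\<close>, write \<open>circ\<close>
  as the right twist of \<open>tw\<close> by \<open>sg\<close> and move this \<open>sg\<close>
  across the tensor sign; the left twist of \<open>bul\<close> by \<open>sg\<close> is
  \<open>tw\<close>.\<close>

lemma SW_tw: "balB f \<Longrightarrow> SW (tw X Y) f = SW2 X Y (\<lambda>x y x' y'. f (tw x y) (tw x' y'))"
  using right_twist_left_twist_move[OF form_sg opm_tw opm_bul, of f X Y]
  by (simp add: SW_tw' circ_eq_right_twist[symmetric] tw_eq_left_twist[symmetric])

lemma circ_assoc: "circ (circ X Y) Z = circ X (circ Y Z)"
proof -
  note b = bal2_left_twist[OF form_sg opm_mult]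
  have "circ (circ X Y) Z = SW X (\<lambda>x x'. SW Y (\<lambda>y y'. SW Z (\<lambda>z z'. S (sg (circ x y) z) \<cdot> (x' \<cdot> (y' \<cdot> z')))))"
    by (simp add: left_twist_def[of sg "(\<cdot>)" "circ X Y"] SW2_def[of "circ X Y"] SW_circ[OF bal2_fst[OF b]] SW2_def L.mult_assoc)
  also have "\<dots> = SW X (\<lambda>x x'. SW Y (\<lambda>y y'. SW Z (\<lambda>z z'. S (sg x (circ y z)) \<cdot> (x' \<cdot> (y' \<cdot> z')))))"
    by (simp only: sg_cocycle)
  also have "\<dots> = SW Y (\<lambda>y y'. SW Z (\<lambda>z z'. SW X (\<lambda>x x'. S (sg x (circ y z)) \<cdot> (x' \<cdot> (y' \<cdot> z')))))"
    by (subst SW_swap) (intro SW_cong SW_swap)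
  also have "\<dots> = circ X (circ Y Z)"
    by (simp only: left_twist_def[of sg "(\<cdot>)" X] SW2_eq[of X] SW_circ[OF bal2_snd[OF b]] SW2_def[of Y])
  finally show ?thesis .
qed

text \<open>The mixed coproduct \<open>SW_tw'\<close> is the useful one here: it produces
  \<open>ta\<close> evaluated on \<open>bul\<close> and nested \<open>circ\<close>, to which
  \<open>ta_cocycle\<close> and \<open>circ_assoc\<close> apply.\<close>

lemma tw_assoc: "tw (tw X Y) Z = tw X (tw Y Z)"
proof -
  note b = bal2_right_twist[OF form_ta opm_circ]
  have "tw (tw X Y) Z = SW X (\<lambda>x x'. SW Y (\<lambda>y y'. SW Z (\<lambda>z z'. T (ta (bul x' y') z') \<cdot> circ (circ x y) z)))"
    by (simp add: right_twist_def[of circ ta "tw X Y"] SW2_def[of "tw X Y"] SW_tw'[OF bal2_fst[OF b]] SW2_def[of X Y])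
  also have "\<dots> = SW X (\<lambda>x x'. SW Y (\<lambda>y y'. SW Z (\<lambda>z z'. T (ta x' (bul y' z')) \<cdot> circ x (circ y z))))"
    by (simp only: ta_cocycle circ_assoc)
  also have "\<dots> = SW Y (\<lambda>y y'. SW Z (\<lambda>z z'. SW X (\<lambda>x x'. T (ta x' (bul y' z')) \<cdot> circ x (circ y z))))"
    by (subst SW_swap) (intro SW_cong SW_swap)
  also have "\<dots> = tw X (tw Y Z)"
    by (simp only: right_twist_def[of circ ta X] SW2_eq[of X] SW_tw'[OF bal2_snd[OF b]] SW2_def[of Y])
  finally show ?thesis .
qed

lemma counit_circ: "e (circ X Y) = sg X Y"
  using conv_counit[OF form_sg, of X Y]
  by (simp add: left_twist_def conv_def SW2_def counit_SW counit_S)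

text \<open>The counit turns the two twists into the convolution of \<open>sg\<close> with
  \<open>ta\<close>, which is the unit.\<close>

lemma counit_tw: "e (tw X Y) = e (X \<cdot> Y)"
  using fun_cong[OF fun_cong[OF conv_sg_ta], of X Y]
  by (simp add: right_twist_def[of circ] conv_def SW2_def counit_SW counit_T counit_circ)

section \<open>The bialgebroid axioms for the twist\<close>

lemma twist_simps:
  "scal (twist L \<sigma> \<tau>) = scal L" "prd (twist L \<sigma> \<tau>) = tw" "uno (twist L \<sigma> \<tau>) = \<one>"
  "src (twist L \<sigma> \<tau>) = S" "tgt (twist L \<sigma> \<tau>) = T" "comult (twist L \<sigma> \<tau>) = comult L"
  "counit (twist L \<sigma> \<tau>) = e"
  by (simp_all add: twist_def twisted_product_eq)

lemma twist_rel:
  "rel_B (twist L \<sigma> \<tau>) = rel_B L" "rel_BB (twist L \<sigma> \<tau>) = rel_BB L" "rel_op (twist L \<sigma> \<tau>) = rel_op L"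
  by (simp_all add: rel_B_def rel_BB_def rel_op_def twist_simps tw_S tw_T)

lemma twist_sw: "sw (twist L \<sigma> \<tau>) = sw L"
  by (simp add: sw_def[abs_def] twist_simps twist_rel)

lemma sw_takeuchi: "tsum (rel_B L) [(X1 \<cdot> T b, X2). (X1, X2) \<leftarrow> sw L X] = tsum (rel_B L) [(X1, X2 \<cdot> S b). (X1, X2) \<leftarrow> sw L X]"
  using SW_tak[of _ X b] by (intro tsum_B_eqI) (simp add: SW_def sum_list_concat_map case_prod_unfold comp_def)

lemma k_algebra_twist: "k_algebra (scal (twist L \<sigma> \<tau>)) (prd (twist L \<sigma> \<tau>)) (uno (twist L \<sigma> \<tau>))"
proof -
  \<comment> \<open>Scalars from k give central elements of the untwisted algebra. Since
    \<open>tw\<close> is balanced over \<open>S\<close>, a scalar can therefore pass its first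
    argument.\<close>
  have "x \<cdot> S (scaleB c 1) = S (scaleB c 1) \<cdot> x" for c x
    using L.mult_scale_right[of x c \<one>] by (simp add: s.scale S_one L.mult_scale_left L.mult_one_left L.mult_one_right)
  then have "tw x (scal L c y) = scal L c (tw x y)" for c x y
    by (simp add: scal_eq_S opmD(3)[OF opm_tw] opmD(5)[OF opm_tw, symmetric])
  moreover have "tw (scal L c x) y = scal L c (tw x y)" for c x y
    by (simp add: scal_eq_S opmD(3)[OF opm_tw])
  ultimately show ?thesis
    unfolding twist_simps
    by (intro k_algebra.intro L.vector_space_axioms k_algebra_axioms.intro)
       (simp_all add: tw_assoc tw_one opmD(1,2)[OF opm_tw])
qed

lemma left_bialgebroid_twist: "left_bialgebroid scaleB (twist L \<sigma> \<tau>)"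
proof (intro left_bialgebroid.intro left_bialgebroid_axioms.intro k_algebra_hom.intro
    k_algebra_hom_axioms.intro k_algebra_twist B.k_algebra_axioms t.dom.k_algebra_axioms;
    unfold twist_simps twist_rel twist_sw tw_S tw_T tw_ST)
  show "Vector_Spaces.linear scaleB (scal L) S" "Vector_Spaces.linear scaleB (scal L) T" by unfold_locales
  show "comult L (tw X Y) = tsum (rel_B L) [(tw X1 Y1, tw X2 Y2). (X1, X2) \<leftarrow> sw L X, (Y1, Y2) \<leftarrow> sw L Y]" for X Y
    unfolding tsum_sw[symmetric]
    using SW_tw[of _ X Y]
    by (intro tsum_B_eqI) (simp add: SW_def SW2_def sum_list_concat_map case_prod_unfold comp_def)
  \<comment> \<open>The list \<open>sw L X\<close> itself is the witness.\<close>
  show "comult L X \<in> takeuchi (twist L \<sigma> \<tau>)" for X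
    unfolding takeuchi_def twist_simps twist_rel tw_S tw_T
    using sw_takeuchi[of _ X] tsum_sw[of X, symmetric] by blast
  show "comult L (S b \<cdot> T c \<cdot> X) = tsum (rel_B L) [(S b \<cdot> X1, T c \<cdot> X2). (X1, X2) \<leftarrow> sw L X]" for b c X
    by (rule comult_bimodule)
  show "e (S b \<cdot> T c \<cdot> X) = b * e X * c" for b c X
    by (rule counit_bimodule)
qed (simp_all add: S_mult T_mult S_one T_one ST comult_in comult_add coassoc counit_left counit_right
       comult_one counit_one counit_S counit_mult_src counit_mult_tgt counit_tw counit_add)

end

section \<open>The translation map of a left Hopf algebroid\<close>

context left_bialgebroid
begin

text \<open>This makes \<lambda> well defined over the opposite algebra: \<open>T b\<close> on the
  right of \<open>X\<close> lands on the second leg of its coproduct.\<close>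

lemma balO_galois:
  assumes f: "balB f"
  shows "balO (\<lambda>X Y. SW X (\<lambda>x x'. f x (x' \<cdot> Y)))"
proof -
  have b: "balB (\<lambda>x x'. f x (x' \<cdot> Y))" for Y
    using f by (simp add: bal_defs alg_simps)
  show ?thesis
    by (rule balOI) (simp_all add: SW_add[OF b] SW_rT[OF b] SW_addf balBD[OF f] alg_simps)
qed

lemma galois_tsum:
  "galois L (tsum (rel_op L) gs) = tsum (rel_B L) [(X1, X2 \<cdot> Y). (X, Y) \<leftarrow> gs, (X1, X2) \<leftarrow> sw L X]"
  unfolding galois_def
proof (rule tsum_B_eqI)
  fix f :: "'l \<Rightarrow> 'l \<Rightarrow> 'k" assume f: "balB f"
  let ?gs = "summands (rel_op L) (tsum (rel_op L) gs)"
  have "tsum (rel_op L) ?gs = tsum (rel_op L) gs"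
    by (rule tsum_summands_op) (rule tsum_in)
  from tsum_op_sum[OF this balO_galois[OF f]]
  show "(\<Sum>(x, y)\<leftarrow>[(X1, X2 \<cdot> Y). (X, Y) \<leftarrow> ?gs, (X1, X2) \<leftarrow> sw L X]. f x y)
    = (\<Sum>(x, y)\<leftarrow>[(X1, X2 \<cdot> Y). (X, Y) \<leftarrow> gs, (X1, X2) \<leftarrow> sw L X]. f x y)"
    by (simp add: SW_def sum_list_concat_map case_prod_unfold comp_def)
qed

lemma sum_galois:
  "(\<Sum>(x, y)\<leftarrow>[(X1, X2 \<cdot> Y). (X, Y) \<leftarrow> gs, (X1, X2) \<leftarrow> sw L X]. f x y)
    = (\<Sum>(X, Y)\<leftarrow>gs. SW X (\<lambda>x x'. f x (x' \<cdot> Y)))"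
  by (simp add: SW_def sum_list_concat_map case_prod_unfold comp_def)

lemma balO_mult_right: "balO g \<Longrightarrow> balO (\<lambda>p m. g p (m \<cdot> a))"
  by (simp add: balO_def biadditive_def alg_simps)

end

context left_hopf_algebroid
begin

definition PM :: "'c \<Rightarrow> ('c \<Rightarrow> 'c \<Rightarrow> 'v::ab_group_add) \<Rightarrow> 'v" where
  "PM X g = (\<Sum>(p, m)\<leftarrow>pm L X. g p m)"

lemma PM_cong: "(\<And>p m. f p m = g p m) \<Longrightarrow> PM X f = PM X g"
  by (metis ext)

lemma PM_addf: "PM X (\<lambda>x y. f x y + g x y) = PM X f + PM X g"
  by (simp add: PM_def sum_list_addf case_prod_unfold)

lemma PM_swap: "PM X (\<lambda>x x'. SW Y (\<lambda>y y'. f x x' y y')) = SW Y (\<lambda>y y'. PM X (\<lambda>x x'. f x x' y y'))"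
  unfolding SW_def PM_def case_prod_unfold by (rule sum_list_swap)

text \<open>By injectivity of \<lambda>, tensors over the opposite algebra may be compared after
  applying \<lambda>.\<close>

lemma tsum_op_galois_eqI:
  assumes "\<And>f :: 'c \<Rightarrow> 'c \<Rightarrow> 'a. balB f \<Longrightarrow>
    (\<Sum>(X, Y)\<leftarrow>gs. SW X (\<lambda>x x'. f x (x' \<cdot> Y))) = (\<Sum>(X, Y)\<leftarrow>gs'. SW X (\<lambda>x x'. f x (x' \<cdot> Y)))"
  shows "tsum (rel_op L) gs = tsum (rel_op L) gs'"
proof -
  have "galois L (tsum (rel_op L) gs) = galois L (tsum (rel_op L) gs')"
    unfolding galois_tsum by (rule tsum_B_eqI) (simp only: sum_galois assms)
  then show ?thesis
    using galois_bij by (auto simp: bij_betw_def inj_on_def tsum_in)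
qed

text \<open>This is \<lambda> after its inverse at X \<otimes> 1, that is,
  \<open>X\<^sub>+\<^sub>(\<^sub>1\<^sub>) \<otimes> X\<^sub>+\<^sub>(\<^sub>2\<^sub>)X\<^sub>- = X
  \<otimes> 1\<close>.\<close>

lemma PM_counit_mult:
  assumes f: "balB f"
  shows "PM X (\<lambda>p m. SW p (\<lambda>x x'. f x (x' \<cdot> m))) = f X \<one>"
proof -
  let ?z = "tsum (rel_B L) [(X, \<one>)]"
  have z: "?z \<in> galois L ` tensor_space (rel_op L)"
    using galois_bij by (simp add: bij_betw_def tsum_in)
  have "tsum (rel_op L) (pm L X) = galois_inv L ?z"
    unfolding pm_def galois_inv_def by (rule tsum_summands_op) (rule inv_into_into[OF z])
  then have "galois L (tsum (rel_op L) (pm L X)) = ?z"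
    unfolding galois_inv_def by (simp add: f_inv_into_f[OF z])
  from tsum_B_sum[OF this[unfolded galois_tsum] f] show ?thesis
    unfolding sum_galois PM_def by simp
qed

lemma PM_eqI:
  assumes "\<And>f :: 'c \<Rightarrow> 'c \<Rightarrow> 'a. balB f \<Longrightarrow> (\<Sum>(p, m)\<leftarrow>gs. SW p (\<lambda>x x'. f x (x' \<cdot> m))) = f X \<one>"
    and g: "balO g"
  shows "PM X g = (\<Sum>(p, m)\<leftarrow>gs. g p m)"
  unfolding PM_def
proof (rule tsum_op_sum[OF tsum_op_galois_eqI g])
  show "(\<Sum>(p, m)\<leftarrow>pm L X. SW p (\<lambda>x x'. f x (x' \<cdot> m))) = (\<Sum>(p, m)\<leftarrow>gs. SW p (\<lambda>x x'. f x (x' \<cdot> m)))"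
    if "balB f" for f :: "'c \<Rightarrow> 'c \<Rightarrow> 'a"
    using that PM_counit_mult[of f X] by (simp add: assms PM_def)
qed

section \<open>Identities for the translation map\<close>

lemma PM_add: "balO g \<Longrightarrow> PM (X + Y) g = PM X g + PM Y g"
  using PM_eqI[of "pm L X @ pm L Y" "X + Y" g]
  by (simp add: PM_counit_mult[unfolded PM_def] balBD) (simp add: PM_def)

text \<open>Inserting \<open>S b\<close> on the right of the minus part makes \<lambda> produce X
  \<otimes> s(b), which equals t(b)X \<otimes> 1.\<close>

lemma PM_T:
  assumes g: "balO g"
  shows "PM (T b \<cdot> X) g = PM X (\<lambda>p m. g p (m \<cdot> S b))"
proof -
  have "PM (T b \<cdot> X) g = (\<Sum>(p, m)\<leftarrow>map (\<lambda>(p, m). (p, m \<cdot> S b)) (pm L X). g p m)"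
  proof (rule PM_eqI[OF _ g])
    fix f :: "'c \<Rightarrow> 'c \<Rightarrow> 'a" assume f: "balB f"
    from balB_mult[OF f, of \<one> "S b"] have "balB (\<lambda>x y. f x (y \<cdot> S b))" by (simp add: alg_simps)
    from PM_counit_mult[OF this, of X]
    show "(\<Sum>(p, m)\<leftarrow>map (\<lambda>(p, m). (p, m \<cdot> S b)) (pm L X). SW p (\<lambda>x x'. f x (x' \<cdot> m))) = f (T b \<cdot> X) \<one>"
      by (simp add: PM_def case_prod_unfold comp_def alg_simps balBD[OF f])
  qed
  then show ?thesis by (simp add: PM_def case_prod_unfold comp_def)
qed

text \<open>Both sides are sent by \<lambda> to X \<otimes> t(b).\<close>

lemma PM_T_move:
  assumes g: "balO g"
  shows "PM X (\<lambda>p m. g p (m \<cdot> T b)) = PM X (\<lambda>p m. g (T b \<cdot> p) m)"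
proof -
  let ?l = "map (\<lambda>(p, m). (p, m \<cdot> T b)) (pm L X)" and ?r = "map (\<lambda>(p, m). (T b \<cdot> p, m)) (pm L X)"
  have "(\<Sum>(p, m)\<leftarrow>?l. g p m) = (\<Sum>(p, m)\<leftarrow>?r. g p m)"
  proof (rule tsum_op_sum[OF tsum_op_galois_eqI g])
    fix f :: "'c \<Rightarrow> 'c \<Rightarrow> 'a" assume f: "balB f"
    have b: "balB (\<lambda>x y. f x (y \<cdot> T b))" "balB (\<lambda>x y. f x (T b \<cdot> y))" "balB (\<lambda>x y. f x (y \<cdot> m))" for m
      using f by (simp_all add: bal_defs alg_simps)
    show "(\<Sum>(p, m)\<leftarrow>?l. SW p (\<lambda>x x'. f x (x' \<cdot> m))) = (\<Sum>(p, m)\<leftarrow>?r. SW p (\<lambda>x x'. f x (x' \<cdot> m)))"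
      using PM_counit_mult[OF b(1), of X] PM_counit_mult[OF b(2), of X]
      by (simp add: PM_def case_prod_unfold comp_def alg_simps SW_T[OF b(3)])
  qed
  then show ?thesis by (simp add: PM_def case_prod_unfold comp_def)
qed

text \<open>This is the inverse of \<lambda> after \<lambda> at X \<otimes> 1: applying \<lambda> to
  \<open>X\<^sub>1\<^sub>+ \<otimes> X\<^sub>1\<^sub>-X\<^sub>2\<close> gives
  \<open>X\<^sub>1 \<otimes> X\<^sub>2\<close>.\<close>

lemma SW_PM_one:
  assumes g: "balO g"
  shows "SW X (\<lambda>x x'. PM x (\<lambda>p m. g p (m \<cdot> x'))) = g X \<one>"
proof -
  let ?l = "[(p, m \<cdot> x'). (x, x') \<leftarrow> sw L X, (p, m) \<leftarrow> pm L x]"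
  have "(\<Sum>(p, m)\<leftarrow>?l. g p m) = (\<Sum>(p, m)\<leftarrow>[(X, \<one>)]. g p m)"
  proof (rule tsum_op_sum[OF tsum_op_galois_eqI g])
    fix f :: "'c \<Rightarrow> 'c \<Rightarrow> 'a" assume f: "balB f"
    have "balB (\<lambda>x y. f x (y \<cdot> a))" for a
      using f by (simp add: bal_defs alg_simps)
    note * = PM_counit_mult[OF this]
    have "(\<Sum>(p, m)\<leftarrow>?l. SW p (\<lambda>x x'. f x (x' \<cdot> m)))
      = SW X (\<lambda>x x'. PM x (\<lambda>p m. SW p (\<lambda>y y'. f y (y' \<cdot> m \<cdot> x'))))"
      by (simp add: PM_def SW_def sum_list_concat_map case_prod_unfold comp_def L.mult_assoc)
    also have "\<dots> = SW X f" by (simp add: * L.mult_one_left)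
    finally show "(\<Sum>(p, m)\<leftarrow>?l. SW p (\<lambda>x x'. f x (x' \<cdot> m))) = (\<Sum>(p, m)\<leftarrow>[(X, \<one>)]. SW p (\<lambda>x x'. f x (x' \<cdot> m)))"
      by (simp add: L.mult_one_right)
  qed
  then show ?thesis by (simp add: PM_def SW_def sum_list_concat_map case_prod_unfold comp_def)
qed

lemma SW_PM:
  assumes g: "balO g"
  shows "SW X (\<lambda>x x'. PM x (\<lambda>p m. g p (m \<cdot> (x' \<cdot> Y)))) = g X Y"
  using SW_PM_one[OF balO_mult_right[OF g, of Y], of X] by (simp add: alg_simps)

text \<open>
  This is \<open>X\<^sub>+\<^sub>(\<^sub>1\<^sub>) \<otimes> X\<^sub>-\<^sub>(\<^sub>1\<^sub>) \<otimes> X\<^sub>+\<^sub>(\<^sub>2\<^sub>)X\<^sub>-\<^sub>(\<^sub>2\<^sub>) = X\<^sub>+ \<otimes> X\<^sub>- \<otimes> 1\<close>: expand \<open>F\<close> in its first two arguments by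
  \<open>\<lambda>\<^sup>-\<^sup>1\<lambda> = id\<close>, so that \<open>X\<^sub>-\<close> enters only through \<open>\<Delta>(X\<^sub>+\<^sub>(\<^sub>2\<^sub>)X\<^sub>-)\<close>, and contract by \<open>\<lambda>\<lambda>\<^sup>-\<^sup>1 = id\<close>.
\<close>

lemma PM_SW2:
  assumes FB: "\<And>m. balB (\<lambda>p w. F p m w)" and FO: "\<And>w. balO (\<lambda>p m. F p m w)"
  shows "PM U (\<lambda>p m. SW2 p m (\<lambda>p m p' m'. F p m (p' \<cdot> m'))) = PM U (\<lambda>p m. F p m \<one>)"
proof -
  \<comment> \<open>\<open>H x w w'\<close> evaluates \<open>F\<close> at the preimage of x
    \<otimes> w under \<lambda>, with \<open>w'\<close> in the last slot.\<close>
  define H where "H x w w' = PM x (\<lambda>q n. F q (n \<cdot> w) w')" for x w w'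
  have gO: "balO (\<lambda>p m. F p (m \<cdot> w) w')" for w w'
    by (rule balO_mult_right) (rule FO)
  have H_add: "H (x + y) w w' = H x w w' + H y w w'" "H x (w + v) w' = H x w w' + H x v w'"
    "H x w (w' + v') = H x w w' + H x w v'" for x y w v w' v'
    unfolding H_def using FO FB
    by (simp_all add: PM_add[OF gO] L.mult_add_right PM_addf[symmetric] balO_def balB_def biadditive_def)
  have H_T: "H (T b \<cdot> x) w w' = H x (S b \<cdot> w) w'" for b x w w'
    by (simp add: H_def PM_T[OF gO] L.mult_assoc)
  have H_balB: "balB (H x)" for x
    using PM_T_move[OF gO, of x] FB by (intro balBI H_add) (simp add: H_def balB_def L.mult_assoc)
  have fB: "balB (\<lambda>x w. SW w (H x))"
  proof -
    have "H (x + y) = (\<lambda>w w'. H x w w' + H y w w')" "H (T b \<cdot> x) = (\<lambda>w w'. H x (S b \<cdot> w) w')" for x y b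
      by (intro ext H_add H_T)+
    then show ?thesis
      by (intro balBI) (simp_all add: SW_add[OF H_balB] SW_S[OF H_balB] SW_addf)
  qed
  have "PM U (\<lambda>p m. SW2 p m (\<lambda>p m p' m'. F p m (p' \<cdot> m')))
    = PM U (\<lambda>P M. SW P (\<lambda>p p2. SW M (\<lambda>m m2. SW p (\<lambda>x x'. H x (x' \<cdot> m) (p2 \<cdot> m2)))))"
    unfolding SW2_def H_def by (intro PM_cong SW_cong SW_PM[OF FO, symmetric])
  also have "\<dots> = PM U (\<lambda>P M. SW P (\<lambda>p p2. SW p (\<lambda>x x'. SW M (\<lambda>m m2. H x (x' \<cdot> m) (p2 \<cdot> m2)))))"
    by (intro PM_cong SW_cong SW_swap)
  also have "\<dots> = PM U (\<lambda>P M. SW P (\<lambda>x p. SW p (\<lambda>x' p2. SW M (\<lambda>m m2. H x (x' \<cdot> m) (p2 \<cdot> m2)))))"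
    by (intro PM_cong SW_coassoc balB_SW)
       (use H_balB in \<open>simp_all add: bal_defs H_add H_T alg_simps\<close>)
  also have "\<dots> = PM U (\<lambda>P M. SW P (\<lambda>x p. SW (p \<cdot> M) (H x)))"
    by (simp add: SW_mult[OF H_balB])
  also have "\<dots> = SW \<one> (H U)"
    by (rule PM_counit_mult[OF fB])
  also have "\<dots> = PM U (\<lambda>p m. F p m \<one>)"
    by (simp add: SW_one[OF H_balB] H_def alg_simps)
  finally show ?thesis .
qed

end

section \<open>The mixed cocycle identity\<close>

context left_bialgebroid
begin

lemma SW2_SW_swap:
  "SW2 X Y (\<lambda>x y x' y'. SW Z (\<lambda>z z'. F x y x' y' z z')) = SW Z (\<lambda>z z'. SW2 X Y (\<lambda>x y x' y'. F x y x' y' z z'))"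
proof -
  have "SW2 X Y (\<lambda>x y x' y'. SW Z (\<lambda>z z'. F x y x' y' z z'))
    = SW X (\<lambda>x x'. SW Z (\<lambda>z z'. SW Y (\<lambda>y y'. F x y x' y' z z')))"
    unfolding SW2_def by (intro SW_cong SW_swap)
  also have "\<dots> = SW Z (\<lambda>z z'. SW2 X Y (\<lambda>x y x' y'. F x y x' y' z z'))"
    unfolding SW2_def by (rule SW_swap)
  finally show ?thesis .
qed

end

context cocycle_bialgebroid
begin

text \<open>
  Evaluate the cocycle identity at \<open>Z = s(b)\<close> and at \<open>Z = t(b)\<close>: the right hand sides agree, since
  \<open>\<sigma>(\<cdot>, s(b))\<close> and \<open>\<sigma>(\<cdot>, t(b))\<close> both reduce to the counit.
\<close>

lemma sg_S_T: "sg X (Y \<cdot> S b) = sg X (Y \<cdot> T b)"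
proof -
  note b = bal2_left_twist[OF form_sg opm_mult]
  have S: "circ Y (S b) = Y \<cdot> S b" "circ Y (T b) = Y \<cdot> T b" for Y
    using opmD(5,6)[OF opm_circ, of Y b \<one>] by (simp_all add: circ_one alg_simps)
  have "sg Z (S b) = sg Z (T b)" for Z
    using formD(5,6)[OF form_sg, of Z b \<one>] by (simp add: alg_simps counit_rT_rS[symmetric])
  then show ?thesis
    using sg_cocycle[of X Y "S b"] sg_cocycle[of X Y "T b"] by (simp add: S)
qed

section \<open>The operation \<open>Z \<rightharpoonup> M\<close>, here
  \<open>act Z M\<close>\<close>

definition act :: "'l \<Rightarrow> 'l \<Rightarrow> 'l" where
  "act Z M = SW M (\<lambda>m m'. S (ta m Z) \<cdot> m')"

lemma bal_act: "balB (\<lambda>m m'. S (ta m Z) \<cdot> m')"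
  by (simp add: bal_defs formD[OF form_ta] alg_simps)

lemma act_add: "act Z (M + M') = act Z M + act Z M'" "act (Z + Z') M = act Z M + act Z' M"
  by (simp_all add: act_def SW_add[OF bal_act] formD[OF form_ta] alg_simps SW_addf)

lemma act_S: "act Z (S b \<cdot> M) = S b \<cdot> act Z M" and act_T: "act Z (T b \<cdot> M) = T b \<cdot> act Z M"
  by (simp_all add: act_def SW_S[OF bal_act] SW_T[OF bal_act] formD[OF form_ta] alg_simps SW_push_simps)

lemma act_rS: "act Z (M \<cdot> S b) = act (S b \<cdot> Z) M"
  by (simp add: act_def SW_rS[OF bal_act] formD[OF form_ta])

text \<open>The form sees \<open>T b\<close> on the right of the first leg of \<open>M\<close>, and
  the Takeuchi property turns it into \<open>S b\<close> on the right of the second leg.\<close>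

lemma act_rT: "act (T b \<cdot> Z) M = act Z M \<cdot> S b"
  using SW_tak[OF bal_act, of M b Z]
  by (simp add: act_def formD[OF form_ta] SW_push_simps L.mult_assoc)

lemma act_one: "act Z \<one> = S (e Z)"
  by (simp add: act_def SW_one[OF bal_act] alg_simps)

lemma SW_act:
  assumes f: "balB f"
  shows "SW (act Z M) f = SW M (\<lambda>m m'. f (act Z m) m')"
proof -
  have add: "is_additive (\<lambda>X. SW X f)" "is_additive (\<lambda>X. f X Y)" for Y
    using f by (simp_all add: is_additive_def SW_add bal_defs)
  have "SW (act Z M) f = SW M (\<lambda>m m'. SW m' (\<lambda>m2 m3. f (S (ta m Z) \<cdot> m2) m3))"
    by (simp add: act_def SW_push[OF add(1)] SW_S[OF f])
  also have "\<dots> = SW M (\<lambda>m' m3. SW m' (\<lambda>m m2. f (S (ta m Z) \<cdot> m2) m3))"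
    by (rule SW_coassoc[symmetric])
       (use f in \<open>simp_all add: bal_defs formD[OF form_ta] alg_simps\<close>)
  also have "\<dots> = SW M (\<lambda>m m'. f (act Z m) m')"
    by (simp add: act_def SW_push[OF add(2)])
  finally show ?thesis .
qed

lemma counit_act: "e (act Z W) = ta W Z"
proof -
  have "e (act Z W) = SW W (\<lambda>w w'. ta (T (e w') \<cdot> w) Z)"
    by (simp add: act_def counit_SW counit_S formD[OF form_ta])
  also have "\<dots> = ta (SW W (\<lambda>w w'. T (e w') \<cdot> w)) Z"
    by (rule SW_push[symmetric, where h = "\<lambda>x. ta x Z"]) (simp add: is_additive_def formD[OF form_ta])
  finally show ?thesis by (simp add: SW_counit_right)
qed

text \<open>The Takeuchi property of \<open>Y\<close> brings \<open>S c\<close> inside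
  \<open>sg\<close> as \<open>T c\<close>; \<open>sg_S_T\<close> turns this into \<open>S c\<close>,
  which belongs to the first leg of the coproduct of \<open>Y \<cdot> S c\<close>.\<close>

lemma circ_rS: "circ P (Y \<cdot> S c) = circ P Y \<cdot> S c"
proof -
  note b = bal2_snd[OF bal2_left_twist[OF form_sg opm_mult]]
  have "circ P Y \<cdot> S c = SW Y (\<lambda>y y'. SW P (\<lambda>p p'. S (sg p y) \<cdot> (p' \<cdot> (y' \<cdot> S c))))"
    by (simp add: left_twist_def SW2_eq SW_push_simps L.mult_assoc)
  also have "\<dots> = SW Y (\<lambda>y y'. SW P (\<lambda>p p'. S (sg p (y \<cdot> T c)) \<cdot> (p' \<cdot> y')))"
    using SW_tak[OF b[of P], of Y c] by simp
  also have "\<dots> = SW Y (\<lambda>y y'. SW P (\<lambda>p p'. S (sg p (y \<cdot> S c)) \<cdot> (p' \<cdot> y')))"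
    by (simp only: sg_S_T)
  also have "\<dots> = circ P (Y \<cdot> S c)"
    by (simp add: left_twist_def SW2_eq SW_rS[OF b])
  finally show ?thesis by simp
qed

text \<open>The plain product is the left twist of \<open>circ\<close> by \<open>ta\<close>; with
  \<open>MZ\<close> so written, the cocycle identity reassociates
  \<open>sg P (circ _ _)\<close>.\<close>

lemma sg_mult: "sg P (M \<cdot> Z) = SW Z (\<lambda>z z'. sg (circ P (act z M)) z')"
proof -
  have add: "is_additive (sg X)" "is_additive (\<lambda>X. sg X Y)" "is_additive (circ X)" for X Y
    by (simp_all add: is_additive_def formD[OF form_sg] opmD[OF opm_circ])
  have "M \<cdot> Z = left_twist ta circ M Z"
    by (simp add: left_twist_left_twist[OF form_ta form_sg opm_mult] conv_ta_sg left_twist_counit[OF opm_mult])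
  then have "sg P (M \<cdot> Z) = SW2 M Z (\<lambda>m z m' z'. sg P (S (ta m z) \<cdot> circ m' z'))"
    by (simp add: left_twist_def[of ta] SW2_push[OF add(1)])
  also have "\<dots> = SW2 M Z (\<lambda>m z m' z'. sg (circ P (S (ta m z) \<cdot> m')) z')"
    by (simp add: opmD(3)[OF opm_circ, symmetric] sg_cocycle)
  also have "\<dots> = SW Z (\<lambda>z z'. sg (circ P (act z M)) z')"
    by (simp add: SW2_eq act_def SW_push[OF add(3)] SW_push[OF add(2)])
  finally show ?thesis .
qed

text \<open>Coassociativity in \<open>V\<close> brings \<open>sg\<close> and \<open>ta\<close>
  together into the convolution unit, and the Takeuchi property carries the remaining \<epsilon>(Z)
  to the right of \<open>V\<close>.\<close>

lemma SW_SW_act: "SW V (\<lambda>v v'. SW Z (\<lambda>z z'. S (sg v z) \<cdot> act z' v')) = V \<cdot> S (e Z)"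
proof -
  have "SW V (\<lambda>v v'. SW Z (\<lambda>z z'. S (sg v z) \<cdot> act z' v'))
    = SW V (\<lambda>v v'. SW v' (\<lambda>v' v3. SW Z (\<lambda>z z'. S (sg v z) \<cdot> (S (ta v' z') \<cdot> v3))))"
    by (simp add: act_def SW_push_simps) (intro SW_cong SW_swap)
  also have "\<dots> = SW V (\<lambda>v v3. SW v (\<lambda>v v'. SW Z (\<lambda>z z'. S (sg v z) \<cdot> (S (ta v' z') \<cdot> v3))))"
    by (rule SW_coassoc[symmetric]; intro balB_SW)
       (simp_all add: bal_defs formD[OF form_ta] formD[OF form_sg] alg_simps)
  also have "\<dots> = SW V (\<lambda>v v3. S (conv sg ta v Z) \<cdot> v3)"
    by (simp add: conv_def SW2_def SW_push_simps alg_simps)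
  also have "\<dots> = SW V (\<lambda>v v'. S (e (v \<cdot> T (e Z))) \<cdot> v')"
    by (simp add: conv_sg_ta counit_mult_tgt)
  also have "\<dots> = SW V (\<lambda>v v'. S (e v) \<cdot> (v' \<cdot> S (e Z)))"
    by (rule SW_tak) (simp add: bal_defs alg_simps counit_add counit_T)
  also have "\<dots> = V \<cdot> S (e Z)"
    using SW_counit_left[of V] by (simp add: L.mult_assoc[symmetric] SW_mult_right[symmetric])
  finally show ?thesis .
qed

lemma SW_circ_act:
  assumes f: "balB f"
  shows "SW (circ P (act Z M)) f = SW2 P M (\<lambda>p m p' m'. f (circ p (act Z m)) (p' \<cdot> m'))"
proof -
  have "bal2 (\<lambda>p y p' y'. f (circ p y) (p' \<cdot> y'))"
    using f by (simp add: bal_defs opmD[OF opm_circ] alg_simps)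
  from SW_act[OF bal2_snd[OF this]] show ?thesis
    by (simp add: SW_circ[OF f] SW2_eq)
qed

text \<open>
  For a Hopf algebra this is the form \<open>\<tau>(M\<^sub>1, Z) \<sigma>(P, M\<^sub>2) = \<sigma>(P\<^sub>1, M\<^sub>1Z\<^sub>1) \<tau>(P\<^sub>2M\<^sub>2, Z\<^sub>2)\<close> of the cocycle
  identity. The reassociation in \<open>Z\<close> is legitimate only because of \<open>circ_rS\<close>, that is, of \<open>sg_S_T\<close>.
\<close>

lemma circ_act: "circ P (act Z M) = SW2 P M (\<lambda>p m p' m'. SW Z (\<lambda>z z'. S (sg p (m \<cdot> z)) \<cdot> act z' (p' \<cdot> m')))"
proof -
  define N where "N z1 z2 z3 = SW (circ P (act z1 M)) (\<lambda>v v'. S (sg v z2) \<cdot> act z3 v')" for z1 z2 z3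
  have b: "balB (\<lambda>v v'. S (sg v z2) \<cdot> act z3 v')" for z2 z3
    by (simp add: bal_defs formD[OF form_sg] act_add act_S alg_simps)
  have N_add: "N (z1 + z1') z2 z3 = N z1 z2 z3 + N z1' z2 z3" "N z1 (z2 + z2') z3 = N z1 z2 z3 + N z1 z2' z3"
    "N z1 z2 (z3 + z3') = N z1 z2 z3 + N z1 z2 z3'" for z1 z1' z2 z2' z3 z3'
    by (simp_all add: N_def act_add opmD[OF opm_circ] SW_add[OF b] formD[OF form_sg] alg_simps SW_addf)
  have N1: "balB (\<lambda>z1 z2. N z1 z2 z3)" for z3
    by (intro balBI N_add) (simp add: N_def act_rT circ_rS SW_rS[OF b] formD[OF form_sg])
  have N2: "balB (N z1)" for z1
  proof (intro balBI N_add)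
    show "N z1 (T b \<cdot> z2) z3 = N z1 z2 (S b \<cdot> z3)" for b z2 z3
      using SW_tak[OF b, of "circ P (act z1 M)" b z2 z3] by (simp add: N_def act_rS formD[OF form_sg])
  qed
  have "SW2 P M (\<lambda>p m p' m'. SW Z (\<lambda>z z'. S (sg p (m \<cdot> z)) \<cdot> act z' (p' \<cdot> m')))
    = SW2 P M (\<lambda>p m p' m'. SW Z (\<lambda>z z3. SW z (\<lambda>z1 z2. S (sg (circ p (act z1 m)) z2) \<cdot> act z3 (p' \<cdot> m'))))"
    by (simp add: sg_mult SW_push_simps)
  also have "\<dots> = SW Z (\<lambda>z z3. SW z (\<lambda>z1 z2. SW2 P M (\<lambda>p m p' m'. S (sg (circ p (act z1 m)) z2) \<cdot> act z3 (p' \<cdot> m'))))"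
    by (simp only: SW2_SW_swap)
  also have "\<dots> = SW Z (\<lambda>z z3. SW z (\<lambda>z1 z2. N z1 z2 z3))"
    by (simp add: N_def SW_circ_act[OF b])
  also have "\<dots> = SW Z (\<lambda>z1 z. SW z (N z1))"
    by (rule SW_coassoc[OF N1 N2])
  \<comment> \<open>The last two legs of \<open>Z\<close> meet in \<open>SW_SW_act\<close>; the
    counit left over is then pushed back into \<open>Z\<close> through \<open>circ_rS\<close> and
    \<open>act_rT\<close>.\<close>
  also have "\<dots> = SW Z (\<lambda>z1 z. circ P (act z1 M) \<cdot> S (e z))"
    unfolding N_def[abs_def] by (subst SW_swap) (simp add: SW_SW_act)
  also have "\<dots> = SW Z (\<lambda>z1 z. circ P (act (T (e z) \<cdot> z1) M))"
    by (simp add: circ_rS[symmetric] act_rT)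
  also have "\<dots> = circ P (act Z M)"
    using SW_push[where h = "\<lambda>Z. circ P (act Z M)" and X = Z and f = "\<lambda>z z'. T (e z') \<cdot> z"]
    by (simp add: SW_counit_right is_additive_def act_add opmD[OF opm_circ])
  finally show ?thesis by simp
qed

text \<open>The counit applied to \<open>circ_act\<close> turns \<open>circ\<close> into
  \<open>sg\<close> and \<open>act\<close> into \<open>ta\<close>.\<close>

lemma sg_act: "sg P (act Z M) = SW2 P M (\<lambda>p m p' m'. SW Z (\<lambda>z z'. sg p (m \<cdot> z) * ta (p' \<cdot> m') z'))"
  using arg_cong[OF circ_act[of P Z M], of e]
  by (simp add: counit_circ SW2_def counit_SW counit_S counit_act)

end

section \<open>The inverse of the twisted Galois map\<close>

context left_bialgebroid
begin

lemma SW2_rS_right: "bal2 F \<Longrightarrow> SW2 X (Y \<cdot> S b) F = SW2 X Y (\<lambda>x y x' y'. F x (y \<cdot> S b) x' y')"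
  by (simp add: SW2_eq SW_rS bal2_snd)
lemma SW2_rT_right: "bal2 F \<Longrightarrow> SW2 X (Y \<cdot> T b) F = SW2 X Y (\<lambda>x y x' y'. F x y x' (y' \<cdot> T b))"
  by (simp add: SW2_eq SW_rT bal2_snd)

lemma SW2_addf: "SW2 X Y (\<lambda>x y x' y'. F x y x' y' + G x y x' y') = SW2 X Y F + SW2 X Y G"
  by (simp add: SW2_def SW_addf)

end

locale cocycle_hopf_algebroid = cocycle_bialgebroid scaleB L \<sigma> \<tau> + left_hopf_algebroid scaleB L
  for scaleB :: "'k::field \<Rightarrow> 'b::{ring, monoid_mult} \<Rightarrow> 'b"
    and L :: "('k, 'b, 'l::ab_group_add) bialgebroid_data" (structure)
    and \<sigma> \<tau> :: "('l \<times> 'l \<Rightarrow>\<^sub>0 'k) set \<Rightarrow> 'b"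
begin

section \<open>The proposed inverse, tested on balanced functions\<close>

text \<open>\<open>pairing\<close>, \<open>pm_pairing\<close> and \<open>inv_sum\<close> build up
  the value of \<open>g\<close> on the claimed formula for the inverse. The threefold coproduct of
  the minus part is hidden in \<open>act\<close>, since by \<open>SW_act\<close> only the first leg
  of \<open>M\<close> is changed in the coproduct of \<open>act Z M\<close>.\<close>

definition pairing :: "('l \<Rightarrow> 'l \<Rightarrow> 'v::ab_group_add) \<Rightarrow> 'l \<Rightarrow> 'l \<Rightarrow> 'v" where
  "pairing g p n = SW2 p n (\<lambda>p n p' n'. g (T (sg p' n') \<cdot> p) n)"

definition pm_pairing :: "('l \<Rightarrow> 'l \<Rightarrow> 'v::ab_group_add) \<Rightarrow> 'l \<Rightarrow> 'l \<Rightarrow> 'v" where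
  "pm_pairing g x x' = PM x (\<lambda>p m. pairing g p (act x' m))"

lemma bal2_pairing:
  assumes g: "balO g"
  shows "bal2 (\<lambda>p n p' n'. g (T (sg p' n') \<cdot> p) n)"
  by (simp add: bal_defs balOD(1,2)[OF g] balOD(3)[OF g, symmetric] formD[OF form_sg] alg_simps)

lemma balO_pairing:
  assumes g: "balO g"
  shows "balO (pairing g)"
  unfolding pairing_def[abs_def]
  by (rule balOI) (simp_all add: SW2_simps bal2_pairing[OF g] formD[OF form_sg])

lemma pairing_rS: "balO g \<Longrightarrow> pairing g p (n \<cdot> S b) = pairing (\<lambda>a c. g a (c \<cdot> S b)) p n"
  by (simp add: pairing_def SW2_rS_right bal2_pairing)

lemma balO_pairing_act:
  assumes g: "balO g"
  shows "balO (\<lambda>p m. pairing g p (act x m))"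
  using balO_pairing[OF g] by (simp add: balO_def biadditive_def act_add act_T)

lemma balB_pm_pairing:
  assumes g: "balO g"
  shows "balB (pm_pairing g)"
proof (rule balBI)
  note b = balO_pairing_act[OF g]
  show "pm_pairing g (T b \<cdot> x) y = pm_pairing g x (S b \<cdot> y)" for b x y
    by (simp add: pm_pairing_def PM_T[OF b] act_rS)
  show "pm_pairing g (x + x') y = pm_pairing g x y + pm_pairing g x' y" for x x' y
    by (simp add: pm_pairing_def PM_add[OF b])
  show "pm_pairing g x (y + y') = pm_pairing g x y + pm_pairing g x y'" for x y y'
    by (simp add: pm_pairing_def act_add balOD[OF balO_pairing[OF g]] PM_addf)
qed

lemma pm_pairing_rT:
  assumes g: "balO g"
  shows "pm_pairing g x (T b \<cdot> x') = pm_pairing (\<lambda>a c. g a (c \<cdot> S b)) x x'"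
  by (simp add: pm_pairing_def act_rT pairing_rS[OF g])

lemma balO_tw: "balO g \<Longrightarrow> balO (\<lambda>a c. g a (tw c Y))"
  by (simp add: balO_def biadditive_def opmD[OF opm_tw])

definition inv_sum :: "('l \<Rightarrow> 'l \<Rightarrow> 'v::ab_group_add) \<Rightarrow> 'l \<Rightarrow> 'l \<Rightarrow> 'v" where
  "inv_sum g X Y = SW X (pm_pairing (\<lambda>a c. g a (tw c Y)))"

text \<open>Well-definedness of the inverse over B: \<open>T b\<close> on \<open>x\<close> reaches
  its second leg, \<open>act_rT\<close> makes it \<open>S b\<close> on the right of the minus part,
  and balance of \<open>tw\<close> passes it to \<open>y\<close>.\<close>

lemma balB_inv_sum:
  assumes g: "balO g"
  shows "balB (inv_sum g)"
proof (rule balBI)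
  note b = balB_pm_pairing[OF balO_tw[OF g]]
  show "inv_sum g (x + x') y = inv_sum g x y + inv_sum g x' y" for x x' y
    by (simp add: inv_sum_def SW_add[OF b])
  show "inv_sum g x (y + y') = inv_sum g x y + inv_sum g x y'" for x y y'
    by (simp add: inv_sum_def pm_pairing_def[abs_def] pairing_def opmD[OF opm_tw] balOD[OF g] SW2_addf PM_addf SW_addf)
  show "inv_sum g (T b \<cdot> x) y = inv_sum g x (S b \<cdot> y)" for b x y
    by (simp add: inv_sum_def SW_T[OF b] pm_pairing_rT[OF balO_tw[OF g]] opmD[OF opm_tw])
qed

text \<open>Sum over \<open>M\<close> first in \<open>bul = left_twist ta tw\<close>.\<close>

lemma bul_act: "bul M X = SW X (\<lambda>x x'. tw (act x M) x')"
proof -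
  have "is_additive (\<lambda>m. tw m x')" for x'
    by (simp add: is_additive_def opmD[OF opm_tw])
  from SW_push[OF this] have "SW X (\<lambda>x x'. tw (act x M) x') = SW X (\<lambda>x x'. SW M (\<lambda>m m'. tw (S (ta m x) \<cdot> m') x'))"
    by (simp add: act_def)
  also have "\<dots> = left_twist ta tw M X"
    by (simp add: left_twist_def[of ta] SW2_eq opmD[OF opm_tw])
  finally show ?thesis by (simp add: bul_eq_left_twist)
qed

lemma SW_T_sg_one: "SW X (\<lambda>x x'. g (T (sg x' \<one>) \<cdot> x)) = g X" if "is_additive g"
  using SW_push[OF that, of X "\<lambda>x x'. T (e x') \<cdot> x"] by (simp add: SW_counit_right)

text \<open>The factor t(\<tau>) of \<open>bul\<close> crosses the tensor sign to the right of
  \<open>p\<close>, becomes s(\<tau>) on the right of \<open>p'\<close> by the Takeuchi property,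
  and crosses inside \<open>sg\<close> onto \<open>m'\<close>, where it forms
  \<open>act\<close>.\<close>

lemma SW2_sg_bul:
  assumes g: "balO g"
  shows "SW2 p m (\<lambda>p m p' m'. g (T (sg p' m') \<cdot> p) (bul m X))
    = SW X (\<lambda>x x'. SW2 p m (\<lambda>p m p' m'. g (T (sg p' (act x' m')) \<cdot> p) (m \<cdot> x)))"
proof -
  have add: "is_additive (g a)" for a
    using g by (simp add: is_additive_def balO_def biadditive_def)
  have "SW2 p m (\<lambda>p m p' m'. g (T (sg p' m') \<cdot> p) (bul m X))
    = SW2 p m (\<lambda>p m p' m'. SW X (\<lambda>x x'. SW m (\<lambda>m m2. g (T (sg p' m') \<cdot> p) (T (ta m2 x') \<cdot> (m \<cdot> x)))))"
    by (simp add: right_twist_def SW2_eq[of _ X] SW_push[OF add])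
  also have "\<dots> = SW X (\<lambda>x x'. SW2 p m (\<lambda>p m p' m'. SW m (\<lambda>m m2. g (T (sg p' m') \<cdot> p) (T (ta m2 x') \<cdot> (m \<cdot> x)))))"
    by (simp only: SW2_SW_swap)
  also have "\<dots> = SW X (\<lambda>x x'. SW2 p m (\<lambda>p m p' m'. g (T (sg p' (act x' m')) \<cdot> p) (m \<cdot> x)))"
  proof (rule SW_cong)
    fix x x'
    have b: "balB (\<lambda>u v. g (T (sg v w) \<cdot> u) a)" for w a
      using g by (simp add: balO_def bal_defs formD[OF form_sg] alg_simps)
    have "SW2 p m (\<lambda>p m p' m'. SW m (\<lambda>m m2. g (T (sg p' m') \<cdot> p) (T (ta m2 x') \<cdot> (m \<cdot> x))))
      = SW m (\<lambda>m m'. SW m (\<lambda>m m2. SW p (\<lambda>p p'. g (T (sg p' m') \<cdot> (p \<cdot> T (ta m2 x'))) (m \<cdot> x))))"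
      by (simp add: SW2_eq SW_swap[of p] balOD(3)[OF g, symmetric] L.mult_assoc)
    also have "\<dots> = SW m (\<lambda>m m'. SW m (\<lambda>m m2. SW p (\<lambda>p p'. g (T (sg p' (S (ta m2 x') \<cdot> m')) \<cdot> p) (m \<cdot> x))))"
      by (simp add: SW_tak[OF b] formD[OF form_sg])
    also have "\<dots> = SW m (\<lambda>m m'. SW m' (\<lambda>m2 m'. SW p (\<lambda>p p'. g (T (sg p' (S (ta m2 x') \<cdot> m')) \<cdot> p) (m \<cdot> x))))"
    proof (rule SW_coassoc)
      show "balB (\<lambda>m m2. SW p (\<lambda>p p'. g (T (sg p' (S (ta m2 x') \<cdot> m')) \<cdot> p) (m \<cdot> x)))" for m'
      proof (rule balBI)
        fix b m m2
        have "SW p (\<lambda>p p'. g (T (sg p' (S (ta m2 x') \<cdot> m')) \<cdot> p) (T b \<cdot> m \<cdot> x))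
          = SW p (\<lambda>p p'. g (T (sg p' (S (ta m2 x') \<cdot> m')) \<cdot> (p \<cdot> T b)) (m \<cdot> x))"
          by (simp add: balOD(3)[OF g, symmetric] L.mult_assoc)
        also have "\<dots> = SW p (\<lambda>p p'. g (T (sg p' (S (ta (S b \<cdot> m2) x') \<cdot> m')) \<cdot> p) (m \<cdot> x))"
          by (simp add: SW_tak[OF b] formD[OF form_sg] formD[OF form_ta] alg_simps)
        finally show "SW p (\<lambda>p p'. g (T (sg p' (S (ta m2 x') \<cdot> m')) \<cdot> p) (T b \<cdot> m \<cdot> x))
          = SW p (\<lambda>p p'. g (T (sg p' (S (ta (S b \<cdot> m2) x') \<cdot> m')) \<cdot> p) (m \<cdot> x))" .
      qed (use g in \<open>simp_all add: balO_def biadditive_def formD[OF form_sg] formD[OF form_ta] alg_simps SW_addf\<close>)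
      show "balB (\<lambda>m2 m'. SW p (\<lambda>p p'. g (T (sg p' (S (ta m2 x') \<cdot> m')) \<cdot> p) (m \<cdot> x)))" for m
        by (intro balB_SW)
           (use g in \<open>simp add: balO_def bal_defs formD[OF form_sg] formD[OF form_ta] alg_simps\<close>)
    qed
    also have "\<dots> = SW m (\<lambda>m m'. SW p (\<lambda>p p'. SW m' (\<lambda>m2 m'. g (T (sg p' (S (ta m2 x') \<cdot> m')) \<cdot> p) (m \<cdot> x))))"
      by (intro SW_cong SW_swap)
    also have "\<dots> = SW2 p m (\<lambda>p m p' m'. g (T (sg p' (act x' m')) \<cdot> p) (m \<cdot> x))"
    proof -
      have "is_additive (\<lambda>n. g (T (sg p' n) \<cdot> p) (m \<cdot> x))" for p' p m
        using g by (simp add: is_additive_def balO_def biadditive_def formD[OF form_sg] alg_simps)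
      from SW_push[OF this] show ?thesis
        by (simp add: SW2_eq act_def)
    qed
    finally show "SW2 p m (\<lambda>p m p' m'. SW m (\<lambda>m m2. g (T (sg p' m') \<cdot> p) (T (ta m2 x') \<cdot> (m \<cdot> x))))
      = SW2 p m (\<lambda>p m p' m'. g (T (sg p' (act x' m')) \<cdot> p) (m \<cdot> x))" .
  qed
  finally show ?thesis .
qed

text \<open>\<open>sg_act\<close> leaves a factor \<open>ta (p' \<cdot> m') z'\<close>, stored as
  the last argument of \<open>F\<close>; \<open>PM_SW2\<close> replaces that argument by
  \<open>\<one>\<close>, and normalisation makes the factor a counit.\<close>

lemma PM_sg_act:
  assumes g: "balO g"
  shows "PM U (\<lambda>p m. SW2 p m (\<lambda>p m p' m'. g (T (sg p' (act Z m')) \<cdot> p) (m \<cdot> x)))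
    = PM U (\<lambda>p m. SW2 p m (\<lambda>p m p' m'. g (T (sg p' (m' \<cdot> Z)) \<cdot> p) (m \<cdot> x)))"
proof -
  define F where "F z z' p m w = SW2 p m (\<lambda>p m p' m'. g (T (sg p' (m' \<cdot> z) * ta w z') \<cdot> p) (m \<cdot> x))"
    for z z' p m w
  have b: "bal2 (\<lambda>p m p' m'. g (T (sg p' (m' \<cdot> z) * c) \<cdot> p) (m \<cdot> x))" for z c
    by (simp add: bal_defs balOD(1,2)[OF g] balOD(3)[OF g, symmetric] formD[OF form_sg] distrib_right mult.assoc alg_simps)
  have FB: "balB (\<lambda>p w. F z z' p m w)" for z z' m
    by (rule balBI)
       (simp_all add: F_def SW2_simps b formD[OF form_sg] formD[OF form_ta] T_add L.mult_add_left distrib_left mult.assoc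
           balOD(1,2)[OF g] SW2_addf)
  have FO: "balO (\<lambda>p m. F z z' p m w)" for z z' w
    by (rule balOI)
       (simp_all add: F_def SW2_simps b formD[OF form_sg] L.mult_assoc)
  have addn: "is_additive (\<lambda>c. g (T c \<cdot> p) a)" for p a
    using g by (simp add: is_additive_def balO_def biadditive_def alg_simps)
  have "SW2 p m (\<lambda>p m p' m'. g (T (sg p' (act Z m')) \<cdot> p) (m \<cdot> x))
    = SW Z (\<lambda>z z'. SW2 p m (\<lambda>p m p' m'. F z z' p m (p' \<cdot> m')))" for p m
  proof -
    have "SW2 p m (\<lambda>p m p' m'. g (T (sg p' (act Z m')) \<cdot> p) (m \<cdot> x))
      = SW Z (\<lambda>z z'. SW2 p m (\<lambda>p m p' m'. SW2 p' m' (\<lambda>p2 m2 p3 m3. g (T (sg p2 (m2 \<cdot> z) * ta (p3 \<cdot> m3) z') \<cdot> p) (m \<cdot> x))))"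
      by (simp only: sg_act SW2_push[OF addn] SW_push[OF addn] SW2_SW_swap)
    also have "\<dots> = SW Z (\<lambda>z z'. SW2 p m (\<lambda>p' m' p3 m3. SW2 p' m' (\<lambda>p m p2 m2. g (T (sg p2 (m2 \<cdot> z) * ta (p3 \<cdot> m3) z') \<cdot> p) (m \<cdot> x))))"
    proof (intro SW_cong SW2_coassoc[symmetric] b)
      show "bal2 (\<lambda>p2 m2 p3 m3. g (T (sg p2 (m2 \<cdot> z) * ta (p3 \<cdot> m3) z') \<cdot> p) (m \<cdot> x))" for z z' p m
        using g by (simp add: balO_def bal_defs formD[OF form_sg] formD[OF form_ta] L.mult_assoc
           L.mult_add_left L.mult_add_right T_add distrib_left distrib_right mult.assoc)
    qed
    finally show ?thesis by (simp add: F_def)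
  qed
  then have "PM U (\<lambda>p m. SW2 p m (\<lambda>p m p' m'. g (T (sg p' (act Z m')) \<cdot> p) (m \<cdot> x)))
    = SW Z (\<lambda>z z'. PM U (\<lambda>p m. SW2 p m (\<lambda>p m p' m'. F z z' p m (p' \<cdot> m'))))"
    by (simp add: PM_swap)
  also have "\<dots> = SW Z (\<lambda>z z'. PM U (\<lambda>p m. F z z' p m \<one>))"
    by (intro SW_cong PM_SW2 FB FO)
  also have "\<dots> = SW Z (\<lambda>z z'. PM U (\<lambda>p m. SW2 p m (\<lambda>p m p' m'. g (T (sg p' (m' \<cdot> (T (e z') \<cdot> z))) \<cdot> p) (m \<cdot> x))))"
  proof (rule SW_cong)
    fix z z'
    define G where "G p m = SW2 p m (\<lambda>p m p' m'. g (T (sg p' (m' \<cdot> z)) \<cdot> p) (m \<cdot> x))" for p m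
    have b': "bal2 (\<lambda>p m p' m'. g (T (sg p' (m' \<cdot> z)) \<cdot> p) (m \<cdot> x))"
      using b[of z 1] by simp
    have "balO G"
      by (rule balOI) (simp_all add: G_def SW2_simps b' formD[OF form_sg] L.mult_assoc)
    \<comment> \<open>The remaining \<open>e z'\<close> amounts to \<open>T (e z')\<close> on the
      left of \<open>p\<close>; \<open>PM_T_move\<close> carries it to the right of
      \<open>m\<close>, hence to the left of \<open>z\<close>.\<close>
    from PM_T_move[OF this, of U "e z'"]
    show "PM U (\<lambda>p m. F z z' p m \<one>)
      = PM U (\<lambda>p m. SW2 p m (\<lambda>p m p' m'. g (T (sg p' (m' \<cdot> (T (e z') \<cdot> z))) \<cdot> p) (m \<cdot> x)))"
      by (simp add: F_def G_def SW2_T_left[OF b'] SW2_rT_right[OF b'] formD[OF form_sg] L.mult_assoc)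
  qed
  also have "\<dots> = PM U (\<lambda>p m. SW2 p m (\<lambda>p m p' m'. g (T (sg p' (m' \<cdot> Z)) \<cdot> p) (m \<cdot> x)))"
  proof -
    have "is_additive (\<lambda>z. g (T (sg p' (m' \<cdot> z)) \<cdot> p) (m \<cdot> x))" for p' m' p m
      using g by (simp add: is_additive_def balO_def biadditive_def alg_simps formD[OF form_sg])
    from SW_push[OF this, where X = Z and f = "\<lambda>z z'. T (e z') \<cdot> z"] show ?thesis
      by (simp add: PM_swap[symmetric] SW2_SW_swap[symmetric] SW_counit_right)
  qed
  finally show ?thesis .
qed

section \<open>The inverse after the twisted Galois map\<close>

text \<open>Coassociativity in \<open>X\<close> assembles \<open>bul m x'\<close> by
  \<open>bul_act\<close>. The two preceding reductions turn the sum into \<open>pairing\<close> at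
  \<open>p\<close> and \<open>m \<cdot> x'\<close>, \<open>SW_PM_one\<close> collapses this to
  \<open>X\<close> and \<open>\<one>\<close>, and normalisation finishes.\<close>

lemma inv_sum_galois:
  assumes g: "balO g"
  shows "SW X (\<lambda>x x'. inv_sum g x (tw x' Y)) = g X Y"
proof -
  define gY where "gY a c = g a (tw c Y)" for a c
  have gY: "balO gY"
    using balO_tw[OF g, of Y] by (simp add: gY_def[abs_def])
  define Q where "Q x3 x1 x2 = pm_pairing (\<lambda>a c. gY a (tw c x3)) x1 x2" for x3 x1 x2
  have Q: "Q x3 x1 x2 = PM x1 (\<lambda>p m. SW2 p m (\<lambda>p m p' m'. gY (T (sg p' m') \<cdot> p) (tw (act x2 m) x3)))" for x1 x2 x3
    using SW_act[OF bal2_snd[OF bal2_pairing[OF balO_tw[OF gY]]]]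
    by (simp add: Q_def pm_pairing_def pairing_def SW2_eq)
  have QB: "balB (\<lambda>x2 x3. Q x3 x1 x2)" for x1
  proof (rule balBI)
    show "Q x3 x1 (x2 + x2') = Q x3 x1 x2 + Q x3 x1 x2'" for x3 x2 x2'
      by (simp add: Q_def balBD[OF balB_pm_pairing[OF balO_tw[OF gY]]])
    show "Q x3 x1 (T b \<cdot> x2) = Q (S b \<cdot> x3) x1 x2" for x3 b x2
      by (simp add: Q_def pm_pairing_rT[OF balO_tw[OF gY]] opmD[OF opm_tw])
    show "Q (x3 + x3') x1 x2 = Q x3 x1 x2 + Q x3' x1 x2" for x3 x3' x2
      by (simp add: Q opmD[OF opm_tw] balOD[OF gY] SW2_addf PM_addf)
  qed
  have "SW X (\<lambda>x x'. inv_sum g x (tw x' Y)) = SW X (\<lambda>x x3. SW x (\<lambda>x1 x2. Q x3 x1 x2))"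
    by (simp add: inv_sum_def Q_def[abs_def] gY_def tw_assoc)
  also have "\<dots> = SW X (\<lambda>x1 x. SW x (\<lambda>x2 x3. Q x3 x1 x2))"
    by (rule SW_coassoc[OF _ QB]) (simp add: Q_def balB_pm_pairing[OF balO_tw[OF gY]])
  also have "\<dots> = SW X (\<lambda>x x'. PM x (\<lambda>p m. SW2 p m (\<lambda>p m p' m'. gY (T (sg p' m') \<cdot> p) (bul m x'))))"
  proof -
    have "is_additive (gY a)" for a
      using gY by (simp add: is_additive_def balO_def biadditive_def)
    from SW_push[OF this] show ?thesis
      by (simp add: Q bul_act PM_swap[symmetric] SW2_SW_swap[symmetric])
  qed
  also have "\<dots> = SW X (\<lambda>x x'. SW x' (\<lambda>y y'. PM x (\<lambda>p m. SW2 p m (\<lambda>p m p' m'. gY (T (sg p' (m' \<cdot> y')) \<cdot> p) (m \<cdot> y)))))"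
    by (simp add: SW2_sg_bul[OF gY] PM_swap PM_sg_act[OF gY])
  also have "\<dots> = SW X (\<lambda>x x'. PM x (\<lambda>p m. pairing gY p (m \<cdot> x')))"
  proof -
    have "pairing gY p (m \<cdot> x') = SW x' (\<lambda>y y'. SW2 p m (\<lambda>p m p' m'. gY (T (sg p' (m' \<cdot> y')) \<cdot> p) (m \<cdot> y)))" for p m x'
      unfolding pairing_def SW2_eq SW_mult[OF bal2_snd[OF bal2_pairing[OF gY]]] by (rule SW_swap)
    then show ?thesis by (simp add: PM_swap)
  qed
  also have "\<dots> = pairing gY X \<one>"
    by (rule SW_PM_one[OF balO_pairing[OF gY]])
  also have "\<dots> = SW X (\<lambda>x x'. gY (T (sg x' \<one>) \<cdot> x) \<one>)"
    by (simp add: pairing_def SW2_eq SW_one[OF bal2_snd[OF bal2_pairing[OF gY]]])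
  also have "\<dots> = gY X \<one>"
    by (rule SW_T_sg_one[where g = "\<lambda>a. gY a \<one>"]) (use gY in \<open>simp add: is_additive_def balO_def biadditive_def\<close>)
  finally show ?thesis by (simp add: gY_def tw_one)
qed

section \<open>The twisted Galois map after the inverse\<close>

text \<open>The twisted Galois map puts \<open>tw\<close> on the second leg of \<open>p\<close>;
  together with the \<open>sg\<close> of \<open>pairing\<close> it forms a right twist of
  \<open>tw\<close>, which is \<open>circ\<close>.\<close>

lemma pairing_galois:
  assumes f: "balB f"
  shows "pairing (\<lambda>X Y. SW X (\<lambda>x x'. f x (tw x' Y))) p n = SW p (\<lambda>p p'. f p (circ p' n))"
proof -
  have b: "balB (\<lambda>x x'. f x (tw x' Y))" for Y
    using f by (simp add: bal_defs opmD[OF opm_tw])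
  have add: "is_additive (f x)" for x
    using f by (simp add: is_additive_def bal_defs)
  have "pairing (\<lambda>X Y. SW X (\<lambda>x x'. f x (tw x' Y))) p n
    = SW p (\<lambda>p p'. SW p (\<lambda>q q'. SW n (\<lambda>n n'. f q (T (sg p' n') \<cdot> tw q' n))))"
    by (simp add: pairing_def SW2_def SW_T[OF b] opmD[OF opm_tw]) (intro SW_cong SW_swap)
  also have "\<dots> = SW p (\<lambda>q p. SW p (\<lambda>q' p'. SW n (\<lambda>n n'. f q (T (sg p' n') \<cdot> tw q' n))))"
    by (intro SW_coassoc balB_SW)
       (use f in \<open>simp_all add: bal_defs formD[OF form_sg] opmD[OF opm_tw] alg_simps\<close>)
  also have "\<dots> = SW p (\<lambda>p p'. f p (right_twist tw sg p' n))"
    by (simp add: right_twist_def[of tw] SW2_def SW_push[OF add])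
  finally show ?thesis by (simp add: circ_eq_right_twist)
qed

text \<open>Parallel to \<open>PM_sg_act\<close>, with \<open>circ_act\<close> itself: after
  \<open>PM_SW2\<close> the remaining \<open>act z' \<one>\<close> is
  \<open>S (e z')\<close>.\<close>

lemma PM_circ_act:
  assumes f: "balB f"
  shows "PM U (\<lambda>p m. SW p (\<lambda>p p'. f p (circ p' (act Z m)))) = PM U (\<lambda>p m. SW p (\<lambda>p p'. f p (S (sg p' (m \<cdot> Z)))))"
proof -
  define F where "F z z' p m w = SW p (\<lambda>p p'. f p (S (sg p' (m \<cdot> z)) \<cdot> act z' w))" for z z' p m w
  have b: "balB (\<lambda>p p'. f p (S (sg p' (m \<cdot> z)) \<cdot> w))" for m z w
    using f by (simp add: bal_defs formD[OF form_sg] alg_simps)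
  have add: "is_additive (f x)" for x
    using f by (simp add: is_additive_def bal_defs)
  have FB: "balB (\<lambda>p w. F z z' p m w)" for z z' m
    by (rule balBI)
       (simp_all add: F_def SW_add[OF b] SW_T[OF b] act_add act_S alg_simps balBD[OF f] SW_addf formD[OF form_sg])
  have FO: "balO (\<lambda>p m. F z z' p m w)" for z z' w
    by (rule balOI)
       (simp_all add: F_def SW_add[OF b] SW_rT[OF b] alg_simps balBD[OF f] SW_addf formD[OF form_sg])
  have "SW p (\<lambda>p p'. f p (circ p' (act Z m))) = SW Z (\<lambda>z z'. SW2 p m (\<lambda>p m p' m'. F z z' p m (p' \<cdot> m')))" for p m
  proof -
    have "SW p (\<lambda>p p'. f p (circ p' (act Z m)))
      = SW Z (\<lambda>z z'. SW p (\<lambda>p p'. SW p' (\<lambda>p2 p3. SW m (\<lambda>m m'. f p (S (sg p2 (m \<cdot> z)) \<cdot> act z' (p3 \<cdot> m'))))))"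
      by (simp only: circ_act SW2_push[OF add] SW_push[OF add] SW2_SW_swap) (simp only: SW2_def SW_swap[of Z p])
    also have "\<dots> = SW Z (\<lambda>z z'. SW p (\<lambda>p p3. SW p (\<lambda>p p2. SW m (\<lambda>m m'. f p (S (sg p2 (m \<cdot> z)) \<cdot> act z' (p3 \<cdot> m'))))))"
      by (intro SW_cong SW_coassoc[symmetric] balB_SW)
         (use f in \<open>simp_all add: bal_defs formD[OF form_sg] act_add act_S alg_simps\<close>)
    also have "\<dots> = SW Z (\<lambda>z z'. SW p (\<lambda>p p3. SW m (\<lambda>m m'. SW p (\<lambda>p p2. f p (S (sg p2 (m \<cdot> z)) \<cdot> act z' (p3 \<cdot> m'))))))"
      by (intro SW_cong SW_swap)
    finally show ?thesis by (simp add: F_def SW2_def)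
  qed
  then have "PM U (\<lambda>p m. SW p (\<lambda>p p'. f p (circ p' (act Z m))))
    = SW Z (\<lambda>z z'. PM U (\<lambda>p m. SW2 p m (\<lambda>p m p' m'. F z z' p m (p' \<cdot> m'))))"
    by (simp add: PM_swap)
  also have "\<dots> = SW Z (\<lambda>z z'. PM U (\<lambda>p m. F z z' p m \<one>))"
    by (intro SW_cong PM_SW2 FB FO)
  also have "\<dots> = SW Z (\<lambda>z z'. PM U (\<lambda>p m. SW p (\<lambda>p p'. f p (S (sg p' (m \<cdot> (T (e z') \<cdot> z)))))))"
  proof (rule SW_cong)
    fix z z'
    define G where "G p m = SW p (\<lambda>p p'. f p (S (sg p' (m \<cdot> z))))" for p m
    have b': "balB (\<lambda>p p'. f p (S (sg p' (m \<cdot> z))))" for m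
      using b[of m z \<one>] by (simp add: alg_simps)
    have "balO G"
      by (rule balOI) (simp_all add: G_def SW_add[OF b'] SW_rT[OF b'] alg_simps balBD[OF f] SW_addf formD[OF form_sg])
    from PM_T_move[OF this, of U "e z'"]
    show "PM U (\<lambda>p m. F z z' p m \<one>) = PM U (\<lambda>p m. SW p (\<lambda>p p'. f p (S (sg p' (m \<cdot> (T (e z') \<cdot> z))))))"
      by (simp add: F_def G_def SW_T[OF b'] act_one formD[OF form_sg] L.mult_assoc S_mult)
  qed
  also have "\<dots> = PM U (\<lambda>p m. SW p (\<lambda>p p'. f p (S (sg p' (m \<cdot> Z)))))"
  proof -
    have "is_additive (\<lambda>z. f p (S (sg p' (m \<cdot> z))))" for p' p m
      using f by (simp add: is_additive_def bal_defs alg_simps formD[OF form_sg])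
    from SW_push[OF this, where X = Z and f = "\<lambda>z z'. T (e z') \<cdot> z"] show ?thesis
      by (simp add: PM_swap[symmetric] SW_swap[of Z] SW_counit_right)
  qed
  finally show ?thesis .
qed

lemma galois_inv_sum:
  assumes f: "balB f"
  shows "inv_sum (\<lambda>X Y. SW X (\<lambda>x x'. f x (tw x' Y))) X Y = f X Y"
proof -
  define fY where "fY u v = f u (tw v Y)" for u v
  have fY: "balB fY"
    using f by (simp add: fY_def bal_defs opmD[OF opm_tw])
  have "inv_sum (\<lambda>X Y. SW X (\<lambda>x x'. f x (tw x' Y))) X Y
    = SW X (\<lambda>x x'. PM x (\<lambda>p m. SW p (\<lambda>p p'. fY p (circ p' (act x' m)))))"
    using pairing_galois[OF fY] by (simp add: inv_sum_def pm_pairing_def[abs_def] fY_def tw_assoc)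
  also have "\<dots> = SW X (\<lambda>x x'. PM x (\<lambda>p m. SW p (\<lambda>p p'. fY p (S (sg p' (m \<cdot> x'))))))"
    by (simp only: PM_circ_act[OF fY])
  also have "\<dots> = SW X (\<lambda>p p'. fY p (S (sg p' \<one>)))"
  proof (rule SW_PM_one)
    have b: "balB (\<lambda>p p'. fY p (S (sg p' w)))" for w
      using fY by (simp add: bal_defs formD[OF form_sg] alg_simps)
    show "balO (\<lambda>p w. SW p (\<lambda>p p'. fY p (S (sg p' w))))"
      by (rule balOI) (simp_all add: SW_add[OF b] SW_rT[OF b] alg_simps balBD[OF fY] SW_addf formD[OF form_sg])
  qed
  also have "\<dots> = SW X (\<lambda>p p'. fY (T (sg p' \<one>) \<cdot> p) \<one>)"
    by (simp add: balBD[OF fY] L.mult_one_right)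
  also have "\<dots> = fY X \<one>"
    by (rule SW_T_sg_one[where g = "\<lambda>a. fY a \<one>"]) (use fY in \<open>simp add: is_additive_def bal_defs\<close>)
  finally show ?thesis by (simp add: fY_def tw_one)
qed

definition inv_list :: "'l \<Rightarrow> 'l \<Rightarrow> ('l \<times> 'l) list" where
  "inv_list X Y = [(T (sg P2 M3) \<cdot> P1, tw (S (ta M1 X2) \<cdot> M2) Y).
      (X1, X2) \<leftarrow> sw L X, (P, M) \<leftarrow> pm L X1, (P1, P2) \<leftarrow> sw L P, (M1, M2, M3) \<leftarrow> sw3 L M]"

text \<open>\<open>sw3\<close> splits the first leg of \<open>M\<close> again, whereas
  \<open>act\<close> followed by a coproduct splits the second; after an exchange of sums,
  coassociativity in \<open>M\<close> relates the two.\<close>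

lemma sum_inv_list:
  assumes g: "balO g"
  shows "(\<Sum>(x, y)\<leftarrow>inv_list X Y. g x y) = inv_sum g X Y"
proof -
  define gY where "gY a c = g a (tw c Y)" for a c
  have gY: "balO gY"
    using balO_tw[OF g, of Y] by (simp add: gY_def[abs_def])
  note b = bal2_snd[OF bal2_pairing[OF gY]]
  have "(\<Sum>(x, y)\<leftarrow>inv_list X Y. g x y) = SW X (\<lambda>x x'. PM x (\<lambda>p m. SW p (\<lambda>p p'. SW m (\<lambda>m m3.
      SW m (\<lambda>m1 m2. gY (T (sg p' m3) \<cdot> p) (S (ta m1 x') \<cdot> m2))))))"
    by (simp add: inv_list_def SW_def PM_def sw3_def gY_def sum_list_concat_map case_prod_unfold comp_def)
  also have "\<dots> = SW X (\<lambda>x x'. PM x (\<lambda>p m. SW m (\<lambda>m m3.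
      SW m (\<lambda>m1 m2. SW p (\<lambda>p p'. gY (T (sg p' m3) \<cdot> p) (S (ta m1 x') \<cdot> m2))))))"
  proof (intro SW_cong PM_cong)
    fix x' p m
    have "SW p (\<lambda>p p'. SW m (\<lambda>m m3. SW m (\<lambda>m1 m2. gY (T (sg p' m3) \<cdot> p) (S (ta m1 x') \<cdot> m2))))
      = SW m (\<lambda>m m3. SW p (\<lambda>p p'. SW m (\<lambda>m1 m2. gY (T (sg p' m3) \<cdot> p) (S (ta m1 x') \<cdot> m2))))"
      by (rule SW_swap)
    also have "\<dots> = SW m (\<lambda>m m3. SW m (\<lambda>m1 m2. SW p (\<lambda>p p'. gY (T (sg p' m3) \<cdot> p) (S (ta m1 x') \<cdot> m2))))"
      by (intro SW_cong SW_swap)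
    finally show "SW p (\<lambda>p p'. SW m (\<lambda>m m3. SW m (\<lambda>m1 m2. gY (T (sg p' m3) \<cdot> p) (S (ta m1 x') \<cdot> m2))))
      = SW m (\<lambda>m m3. SW m (\<lambda>m1 m2. SW p (\<lambda>p p'. gY (T (sg p' m3) \<cdot> p) (S (ta m1 x') \<cdot> m2))))" .
  qed
  also have "\<dots> = SW X (\<lambda>x x'. PM x (\<lambda>p m. SW m (\<lambda>m1 m.
      SW m (\<lambda>m2 m3. SW p (\<lambda>p p'. gY (T (sg p' m3) \<cdot> p) (S (ta m1 x') \<cdot> m2))))))"
  proof (rule SW_cong, rule PM_cong, rule SW_coassoc)
    show "balB (\<lambda>m1 m2. SW p (\<lambda>p p'. gY (T (sg p' m3) \<cdot> p) (S (ta m1 x') \<cdot> m2)))" for p m3 x'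
      by (intro balB_SW) (use gY in \<open>simp add: balO_def bal_defs formD[OF form_ta] alg_simps\<close>)
    show "balB (\<lambda>m2 m3. SW p (\<lambda>p p'. gY (T (sg p' m3) \<cdot> p) (S (ta m1 x') \<cdot> m2)))" for p m1 x'
      using b[of p] by (simp add: balB_def biadditive_def L.mult_add_right ST_left)
  qed
  also have "\<dots> = SW X (\<lambda>x x'. PM x (\<lambda>p m. SW m (\<lambda>m1 m. pairing gY p (S (ta m1 x') \<cdot> m))))"
    by (simp add: pairing_def SW2_eq SW_S[OF b])
  also have "\<dots> = SW X (\<lambda>x x'. PM x (\<lambda>p m. pairing gY p (act x' m)))"
  proof -
    have "is_additive (pairing gY p)" for p
      by (simp add: is_additive_def balOD[OF balO_pairing[OF gY]])
    from SW_push[OF this] show ?thesis by (simp add: act_def)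
  qed
  finally show ?thesis
    by (simp add: inv_sum_def pm_pairing_def[abs_def] gY_def[abs_def])
qed

section \<open>Bijectivity and the explicit inverse\<close>

lemma galois_twist:
  "galois (twist L \<sigma> \<tau>) (tsum (rel_op L) gs)
    = tsum (rel_B L) [(X1, tw X2 Y). (X, Y) \<leftarrow> gs, (X1, X2) \<leftarrow> sw L X]"
  using left_bialgebroid.galois_tsum[OF left_bialgebroid_twist, of gs]
  by (simp only: twist_simps twist_rel twist_sw)

lemma sum_galois_tw:
  "(\<Sum>(x, y)\<leftarrow>[(X1, tw X2 Y). (X, Y) \<leftarrow> gs, (X1, X2) \<leftarrow> sw L X]. f x y)
    = (\<Sum>(X, Y)\<leftarrow>gs. SW X (\<lambda>x x'. f x (tw x' Y)))"
  by (simp add: SW_def sum_list_concat_map case_prod_unfold comp_def)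

lemma balO_galois_tw: "balB f \<Longrightarrow> balO (\<lambda>X Y. SW X (\<lambda>x x'. f x (tw x' Y)))"
proof -
  assume f: "balB f"
  have b: "balB (\<lambda>x x'. f x (tw x' Y))" for Y
    using f by (simp add: bal_defs opmD[OF opm_tw])
  show ?thesis
    by (rule balOI) (simp_all add: SW_add[OF b] SW_rT[OF b] SW_addf balBD[OF f] opmD[OF opm_tw])
qed

text \<open>Tested on balanced functions this is \<open>galois_inv_sum\<close>. It gives
  surjectivity and, for a single pure tensor, the formula for the inverse.\<close>

lemma galois_twist_inv_list:
  "galois (twist L \<sigma> \<tau>) (tsum (rel_op L) (concat (map (\<lambda>(X, Y). inv_list X Y) gs))) = tsum (rel_B L) gs"
  unfolding galois_twist
proof (rule tsum_B_eqI, unfold sum_galois_tw)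
  fix f :: "'l \<Rightarrow> 'l \<Rightarrow> 'k" assume f: "balB f"
  show "(\<Sum>(X, Y)\<leftarrow>concat (map (\<lambda>(X, Y). inv_list X Y) gs). SW X (\<lambda>x x'. f x (tw x' Y))) = (\<Sum>(x, y)\<leftarrow>gs. f x y)"
    by (simp add: sum_list_concat_map case_prod_unfold)
       (simp add: sum_inv_list[OF balO_galois_tw[OF f], unfolded case_prod_unfold] galois_inv_sum[OF f])
qed

text \<open>To compare two preimages under \<open>g\<close>, test their equal images with the
  balanced function \<open>inv_sum g\<close>; \<open>inv_sum_galois\<close> returns
  \<open>g\<close>.\<close>

lemma galois_twist_inj:
  assumes "galois (twist L \<sigma> \<tau>) (tsum (rel_op L) gs) = galois (twist L \<sigma> \<tau>) (tsum (rel_op L) gs')"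
  shows "tsum (rel_op L) gs = tsum (rel_op L) gs'"
proof (rule tsum_op_eqI)
  fix g :: "'l \<Rightarrow> 'l \<Rightarrow> 'k" assume g: "balO g"
  from tsum_B_sum[OF assms[unfolded galois_twist] balB_inv_sum[OF g]]
  show "(\<Sum>(x, y)\<leftarrow>gs. g x y) = (\<Sum>(x, y)\<leftarrow>gs'. g x y)"
    unfolding sum_galois_tw by (simp add: inv_sum_galois[OF g])
qed

lemma tensor_space_op_tsum: "z \<in> tensor_space (rel_op L) \<Longrightarrow> \<exists>gs. z = tsum (rel_op L) gs"
  by (metis tsum_summands_op)

lemma tensor_space_B_tsum: "z \<in> tensor_space (rel_B L) \<Longrightarrow> \<exists>gs. z = tsum (rel_B L) gs"
  by (metis tsum_summands_B)

lemma inj_on_galois_twist: "inj_on (galois (twist L \<sigma> \<tau>)) (tensor_space (rel_op L))"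
  by (rule inj_onI) (metis tensor_space_op_tsum galois_twist_inj)

lemma galois_twist_bij:
  "bij_betw (galois (twist L \<sigma> \<tau>)) (tensor_space (rel_op L)) (tensor_space (rel_B L))"
  unfolding bij_betw_def
proof (intro conjI inj_on_galois_twist equalityI subsetI)
  fix z assume "z \<in> galois (twist L \<sigma> \<tau>) ` tensor_space (rel_op L)"
  then show "z \<in> tensor_space (rel_B L)"
    using tensor_space_op_tsum by (auto simp: galois_twist tsum_in dest!: tensor_space_op_tsum)
next
  fix z assume "z \<in> tensor_space (rel_B L)"
  then obtain gs where "z = tsum (rel_B L) gs" using tensor_space_B_tsum by blast
  then show "z \<in> galois (twist L \<sigma> \<tau>) ` tensor_space (rel_op L)"
    using galois_twist_inv_list[of gs] tsum_in by (metis imageI)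
qed

lemma left_hopf_algebroid_twist: "left_hopf_algebroid scaleB (twist L \<sigma> \<tau>)"
  using left_bialgebroid_twist galois_twist_bij
  by (simp add: left_hopf_algebroid_def left_hopf_algebroid_axioms_def twist_rel)

lemma galois_inv_twist: "galois_inv (twist L \<sigma> \<tau>) (tsum (rel_B L) [(X, Y)]) = tsum (rel_op L) (inv_list X Y)"
  unfolding galois_inv_def twist_rel
  using inv_into_f_f[OF inj_on_galois_twist tsum_in[of "rel_op L" "inv_list X Y"]]
    galois_twist_inv_list[of "[(X, Y)]"] by simp

end

theorem theorem3p7:
  fixes scaleB :: "'k::field \<Rightarrow> 'b::{ring, monoid_mult} \<Rightarrow> 'b"
    and L :: "('k, 'b, 'l::ab_group_add) bialgebroid_data"
    and \<sigma> \<sigma>inv :: "('l \<times> 'l \<Rightarrow>\<^sub>0 'k) set \<Rightarrow> 'b"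
  assumes "left_hopf_algebroid scaleB L"
    and "invertible_2_cocycle L \<sigma> \<sigma>inv"
  shows "left_hopf_algebroid scaleB (twist L \<sigma> \<sigma>inv)
    \<and> (\<forall>X Y. galois (twist L \<sigma> \<sigma>inv) (tsum (rel_op (twist L \<sigma> \<sigma>inv)) [(X, Y)])
           = tsum (rel_B (twist L \<sigma> \<sigma>inv))
               [(X1, twisted_product L \<sigma> \<sigma>inv X2 Y). (X1, X2) \<leftarrow> sw L X])
    \<and> (\<forall>X Y. galois_inv (twist L \<sigma> \<sigma>inv) (tsum (rel_B (twist L \<sigma> \<sigma>inv)) [(X, Y)])
           = tsum (rel_op (twist L \<sigma> \<sigma>inv))
               [(tgt L (app L \<sigma> P2 M3) \<cdot>\<^bsub>L\<^esub> P1,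
                 twisted_product L \<sigma> \<sigma>inv (src L (app L \<sigma>inv M1 X2) \<cdot>\<^bsub>L\<^esub> M2) Y).
                (X1, X2) \<leftarrow> sw L X, (P, M) \<leftarrow> pm L X1,
                (P1, P2) \<leftarrow> sw L P, (M1, M2, M3) \<leftarrow> sw3 L M])"
proof -
  interpret left_hopf_algebroid scaleB L by (rule assms(1))
  interpret cocycle_hopf_algebroid scaleB L \<sigma> \<sigma>inv
    by unfold_locales (rule assms(2))
  show ?thesis
    unfolding twist_rel twisted_product_eq inv_list_def[symmetric]
    using left_hopf_algebroid_twist galois_inv_twist galois_twist[of "[(_, _)]"] by simp
qed

end
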